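(* For every $\alpha\in(0,1)$ and $\gamma>0$, the following holds. (a) The density $x\mapsto\hat h_{\alpha,\gamma}(x)$ is strictly unimodal on $(0,\infty)$. (b) For every $a>0$, one has $\lim_{x\to0^+}x^{-a}\,\hat h_{\alpha,\gamma}(x)=\lim_{x\to0^+}x^{a}\log\hat h_{\alpha,\gamma}(x)=0$. (c) There exists $c\in(0,\infty)$ such that $$\hat h_{\alpha,\gamma}(x)\;\sim\;c\,x^{\frac{\gamma}{1-\alpha}-1}\,e^{-((1-\alpha)x)^{\gamma}}\qquad\text{as }x\to\infty.$$
   Context: For $\alpha\in(0,1)$ and $\gamma>0$, $\hat h_{\alpha,\gamma}$ denotes the probability density on $(0,\infty)$ of the positive random variable $\hat{\mathbf{X}}_{\alpha,\gamma}$ (the $\alpha$-Sun random variable in the Weibull case, up to sign), which solves the integro-differential equation $$\hat h_{\alpha,\gamma}(x)=\frac{\gamma}{x}\int_x^{x/\alpha}(x-\alpha u)^{\gamma}\,\hat h_{\alpha,\gamma}(u)\,du,\qquad x>0.$$ (It is known that such a density exists, and the equation together with $\int_0^\infty\hat h_{\alpha,\gamma}(x)\,dx=1$ determines the law.) A density on $(0,\infty)$ is strictly unimodal if there exists a mode $m\ge0$ such that the density is strictly increasing on $(0,m)$ and strictly decreasing on $(m,\infty)$. The notation $f(x)\sim g(x)$ means $f(x)/g(x)\to1$. *)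

theory Defs
  imports "HOL-Analysis.Analysis" "HOL-Library.Landau_Symbols"
begin

(* The alpha-sun density h-hat (Weibull case, up to sign) lives on (0,oo), so only the
   restriction of h to the positive half-line matters.  The pointwise equation picks the
   version of the density, and together with the normalisation it determines the law; a
   statement about "the" density is a statement about every h satisfying this predicate.
   Since h is integrable on (0,oo) and 0 <= (x - alpha * u)^gamma <= x^gamma on the range
   of integration, the integral in the equation always exists. *)
definition sun_weibull_density :: "real \<Rightarrow> real \<Rightarrow> (real \<Rightarrow> real) \<Rightarrow> bool" where
  "sun_weibull_density \<alpha> \<gamma> h \<longleftrightarrow>
     (\<forall>x>0. h x \<ge> 0) \<and>
     set_integrable lborel {0<..} h \<and>
     (LINT x:{0<..}|lborel. h x) = 1 \<and>
     (\<forall>x>0. h x = \<gamma> / x * (LINT u:{x..x/\<alpha>}|lborel. (x - \<alpha> * u) powr \<gamma> * h u))"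

(* The mode m = 0 is allowed and means strictly decreasing on (0,oo).  For h >= 0 on (0,oo),
   strict unimodality forces h > 0 near 0 (on all of (0,oo) except possibly at m), so ln (h x)
   is then a genuine logarithm for small x, not the default value ln 0 = 0. *)
definition strictly_unimodal_on_pos :: "(real \<Rightarrow> real) \<Rightarrow> bool" where
  "strictly_unimodal_on_pos h \<longleftrightarrow>
     (\<exists>m\<ge>0. strict_mono_on {0<..<m} h \<and> strict_antimono_on {m<..} h)"

end

theory Submission
  imports Defs
begin

text \<open>
  The substitution \<open>v = ((1 - \<alpha>) x) powr \<gamma>\<close> turns the integral equation into a scale-invariant fixed
  point equation \<open>f x = (LINT u. K (u / x) * f u)\<close> with a totally positive (TP2) kernel on \<open>[1, b)\<close>
  satisfying \<open>t powr (-\<beta>) * (1 - O((1 - 1 / t)^2)) \<le> K t \<le> t powr (-\<beta>)\<close>.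

  Tail: for \<open>N x = (LINT u:{x..}. u powr (-\<beta>) * f u)\<close> the upper bound on \<open>K\<close> gives \<open>f x \<le> x powr \<beta> * N x\<close>,
  so \<open>exp x * N x\<close> increases; the lower bound on \<open>K\<close> makes the moments of \<open>f\<close> at most a constant times
  those of the Gamma law, so \<open>exp x * N x\<close> is bounded. Hence \<open>f x\<close> is asymptotic to
  \<open>c * x powr \<beta> * exp (-x)\<close>.

  Unimodality: TP2 kernels preserve log-concavity in \<open>ln x\<close>. The profile \<open>g = c * x powr \<beta> * exp (-x)\<close> has
  this property, and the iterates of the kernel applied to \<open>g\<close> converge to \<open>f\<close>, since \<open>f\<close> and \<open>g\<close>
  are close at infinity and the kernel pushes all mass there. A second look at the TP2 argument makes
  the log-concavity strict, which passes to \<open>h\<close> and leaves room for a single mode.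

  Near zero, \<open>f x = O(x ^ n)\<close> for all \<open>n\<close> by iterating the equation, and monotonicity on the left of the
  mode gives \<open>f x \<ge> \<kappa> * x * f (\<sigma> * x)\<close>, hence \<open>- ln (f x) = O(x powr (-a))\<close> for all \<open>a > 0\<close>.
\<close>

section \<open>Integrals over the line\<close>

text \<open>The number \<open>\<beta> = \<alpha> / (1 - \<alpha>)\<close> is minus the logarithmic
  derivative of the kernel at \<open>1\<close>, and this is what decides the tail: an exponentially
  decaying \<open>f\<close> sees only ratios \<open>u / x = 1 + O(1 / x)\<close>. For the exact
  power kernel \<open>t powr (- \<beta>)\<close> on the whole ray from \<open>1\<close> the equation
  is solved by \<open>x powr \<beta> * exp (- x)\<close>, so every estimate at infinity compares
  \<open>K\<close> with this model. The error in the lower bound has to be of second order: it then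
  costs each step from one moment to the next a factor \<open>1 + O(1 / n^2)\<close>, and the
  product of these converges, whereas a first order error would cost a power of \<open>n\<close> and
  ruin the Gamma comparison. The obstacle at the start is that \<open>f\<close> is merely
  integrable, without moments, decay, positivity or continuity. All of these are extracted from the
  equation itself. Log-concavity in \<open>ln x\<close> is the notion that fits, because the kernel
  depends on \<open>u / x\<close> only and power factors are neutral for it.\<close>

lemma integral_exp_tail:
  fixes \<theta> x :: real
  assumes "0 < \<theta>"
  shows "set_integrable lborel {x..} (\<lambda>u. exp (- \<theta> * u))"
    and "(LINT u:{x..}|lborel. exp (- \<theta> * u)) = exp (- \<theta> * x) / \<theta>"
proof -
  have hi: "((\<lambda>u. exp (- \<theta> * u)) has_integral exp (- \<theta> * x) / \<theta>) {x..}"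
    by (rule has_integral_exp_minus_to_infinity[OF assms])
  then have "set_integrable lebesgue {x..} (\<lambda>u. exp (- \<theta> * u))"
    by (intro nonnegative_absolutely_integrable_1) (auto simp: integrable_on_def)
  then show *: "set_integrable lborel {x..} (\<lambda>u. exp (- \<theta> * u))"
    unfolding set_integrable_def by (subst (asm) integrable_completion) auto
  show "(LINT u:{x..}|lborel. exp (- \<theta> * u)) = exp (- \<theta> * x) / \<theta>"
    using set_borel_integral_eq_integral(2)[OF *] integral_unique[OF hi] by simp
qed

lemma integrable_exp_bound:
  fixes \<phi> :: "real \<Rightarrow> real"
  assumes [measurable]: "\<phi> \<in> borel_measurable borel" and "\<And>u. u \<le> 0 \<Longrightarrow> \<phi> u = 0"
    and "0 < \<theta>" and "\<And>u. 0 < u \<Longrightarrow> \<bar>\<phi> u\<bar> \<le> A * exp (- \<theta> * u)"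
  shows "integrable lborel \<phi>"
proof -
  have "integrable lborel (\<lambda>u. indicator {0..} u * exp (- \<theta> * u))"
    using integral_exp_tail(1)[OF assms(3), of 0] by (simp add: set_integrable_def)
  then have "integrable lborel (\<lambda>u. A * (indicator {0..} u * exp (- \<theta> * u)))"
    by (rule integrable_mult_right)
  then show ?thesis
  proof (rule Bochner_Integration.integrable_bound)
    show "AE u in lborel. norm (\<phi> u) \<le> norm (A * (indicator {0..} u * exp (- \<theta> * u)))"
    proof (intro AE_I2)
      fix u show "norm (\<phi> u) \<le> norm (A * (indicator {0..} u * exp (- \<theta> * u)))"
        using assms(2)[of u] assms(4)[of u] by (cases "0 < u") auto
    qed
  qed simp
qed

text \<open>The source of the strict inequalities between integrals below: a vanishing integral
  would make the interval of positivity a null set.\<close>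

lemma integral_pos_interval:
  fixes \<phi> :: "real \<Rightarrow> real"
  assumes int: "integrable lborel \<phi>" and nn: "\<And>u. 0 \<le> \<phi> u"
    and "c < d" and pos: "\<And>u. c < u \<Longrightarrow> u < d \<Longrightarrow> 0 < \<phi> u"
  shows "0 < (LINT u|lborel. \<phi> u)"
proof -
  have "(LINT u|lborel. \<phi> u) \<noteq> 0"
  proof
    assume "(LINT u|lborel. \<phi> u) = 0"
    then have "AE u in lborel. \<phi> u = 0"
      using integral_nonneg_eq_0_iff_AE[OF int] nn by simp
    then have "AE u in lborel. u \<notin> {c<..<d}"
      using pos by (auto elim!: eventually_mono) fastforce
    then have "emeasure lborel {c<..<d} = 0"
      by (subst (asm) AE_iff_measurable[where N = "{c<..<d}"]) auto
    then show False using \<open>c < d\<close> by simp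
  qed
  then show ?thesis using Bochner_Integration.integral_nonneg[of lborel \<phi>] nn by (simp add: less_le)
qed

section \<open>TP2 kernels and multiplicative log-concavity\<close>

text \<open>Concavity of \<open>ln (\<phi> (exp s))\<close> in \<open>s\<close>, written as "the
  ratio \<open>\<phi> (\<rho> * x) / \<phi> x\<close> decreases in \<open>x\<close>" and
  cross-multiplied. The product form involves neither division nor derivatives and survives
  pointwise limits.\<close>

definition mult_log_concave :: "(real \<Rightarrow> real) \<Rightarrow> bool" where
  "mult_log_concave \<phi> \<longleftrightarrow> (\<forall>x x' \<rho>. 0 < x \<longrightarrow> x \<le> x' \<longrightarrow> 1 \<le> \<rho> \<longrightarrow> \<phi> x * \<phi> (\<rho> * x') \<le> \<phi> (\<rho> * x) * \<phi> x')"

lemma mult_log_concaveD: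
  "mult_log_concave \<phi> \<Longrightarrow> 0 < x \<Longrightarrow> x \<le> x' \<Longrightarrow> 1 \<le> \<rho> \<Longrightarrow> \<phi> x * \<phi> (\<rho> * x') \<le> \<phi> (\<rho> * x) * \<phi> x'"
  unfolding mult_log_concave_def by blast

text \<open>The two power bounds together force \<open>K 1 = 1\<close> and fix the right-hand
  logarithmic derivative \<open>- \<beta>\<close> there. Hence \<open>K\<close> jumps at
  \<open>1\<close>, the one point left out of \<open>K_isCont\<close>. The TP2 inequality is imposed
  for all real \<open>u\<close> and \<open>v\<close>, so it also covers the zeros of
  \<open>K\<close> outside \<open>[1, b)\<close>.\<close>

locale log_concave_kernel =
  fixes K :: "real \<Rightarrow> real" and b \<beta> C :: real
  assumes b_gt_1: "1 < b" and \<beta>_pos: "0 < \<beta>" and C_nonneg: "0 \<le> C"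
    and K_borel [measurable]: "K \<in> borel_measurable borel"
    and K_pos: "1 \<le> t \<Longrightarrow> t < b \<Longrightarrow> 0 < K t"
    and K_eq_0: "t < 1 \<or> b \<le> t \<Longrightarrow> K t = 0"
    and K_isCont: "t \<noteq> 1 \<Longrightarrow> isCont K t"
    and K_tp2: "0 < x \<Longrightarrow> x \<le> x' \<Longrightarrow> u \<le> v \<Longrightarrow> K (v / x) * K (u / x') \<le> K (u / x) * K (v / x')"
    and K_upper: "1 \<le> t \<Longrightarrow> K t \<le> t powr (- \<beta>)"
    and K_lower: "1 \<le> t \<Longrightarrow> t powr (- \<beta>) * (1 - C * (1 - 1 / t)\<^sup>2) \<le> K t"
begin

lemma K_nonneg: "0 \<le> K t"
  using K_pos[of t] K_eq_0[of t] by fastforce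

lemma K_le_1: "K t \<le> 1"
proof (cases "1 \<le> t")
  case True
  then have "t powr (-\<beta>) \<le> t powr 0" using \<beta>_pos by (intro powr_mono) auto
  then show ?thesis using K_upper[OF True] True by simp
qed (simp add: K_eq_0)

lemma integrable_K_mult:
  assumes "integrable lborel \<phi>"
  shows "integrable lborel (\<lambda>u. K (u / x) * \<phi> u)"
proof (rule Bochner_Integration.integrable_bound[OF assms])
  show "(\<lambda>u. K (u / x) * \<phi> u) \<in> borel_measurable lborel"
    using borel_measurable_integrable[OF assms] by simp
  show "AE u in lborel. norm (K (u / x) * \<phi> u) \<le> norm (\<phi> u)"
    using K_nonneg K_le_1 by (auto simp: abs_mult intro!: mult_left_le_one_le AE_I2)
qed

text \<open>The value \<open>0\<close> on the left half-line turns the equation for \<open>f\<close>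
  into an identity of functions \<open>f = T f\<close>, so that results about
  \<open>T \<phi>\<close> can be rewritten with it.\<close>

definition T :: "(real \<Rightarrow> real) \<Rightarrow> real \<Rightarrow> real" where
  "T \<phi> x = (if 0 < x then (LINT u|lborel. K (u / x) * \<phi> u) else 0)"

lemma T_scale:
  assumes "0 < x" "0 < \<rho>"
  shows "T \<phi> (\<rho> * x) = \<rho> * (LINT u|lborel. K (u / x) * \<phi> (\<rho> * u))"
  using assms lborel_integral_real_affine[of \<rho> "\<lambda>u. K (u / (\<rho> * x)) * \<phi> u" 0]
  by (simp add: T_def)

lemma integral_K_pos:
  assumes "integrable lborel \<phi>" "0 < x" "x < c" "\<And>u. 0 \<le> \<phi> u" "\<And>u. x < u \<Longrightarrow> u < c \<Longrightarrow> 0 < \<phi> u"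
  shows "0 < (LINT u|lborel. K (u / x) * \<phi> u)"
proof (rule integral_pos_interval[OF integrable_K_mult[OF assms(1)]])
  show "x < min c (b * x)" using assms b_gt_1 by simp
  show "0 < K (u / x) * \<phi> u" if "x < u" "u < min c (b * x)" for u
    using that assms K_pos[of "u / x"] by (auto simp: field_simps)
qed (use assms K_nonneg in auto)

text \<open>By TP2, \<open>K (u / x') / K (u / x)\<close> increases in \<open>u\<close>; comparing it with its value at the sign
  change \<open>us\<close> of \<open>w\<close> shows that the weight \<open>K (u / x)\<close> favours the positive part of \<open>w\<close>.\<close>
lemma threshold:
  assumes int: "integrable lborel w"
    and x: "0 < x" "x \<le> x'" and us: "x' \<le> us" "us \<le> b * x'"
    and pos: "\<And>u. x \<le> u \<Longrightarrow> u < us \<Longrightarrow> 0 \<le> w u"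
    and neg: "\<And>u. us < u \<Longrightarrow> u \<le> b * x' \<Longrightarrow> w u \<le> 0"
    and avg: "0 \<le> (LINT u|lborel. K (u / x') * w u)"
  shows "(LINT u:{x..<x'}|lborel. K (u / x) * w u) \<le> (LINT u|lborel. K (u / x) * w u)"
proof -
  have i: "integrable lborel (\<lambda>u. K (u / x) * w u)" "integrable lborel (\<lambda>u. K (u / x') * w u)"
    using int by (auto intro: integrable_K_mult)
  have si: "set_integrable lborel {x..<x'} (\<lambda>u. K (u / x) * w u)" 
     "set_integrable lborel {x'..} (\<lambda>u. K (u / x) * w u)"
    unfolding set_integrable_def using integrable_mult_indicator[OF _ i(1)] by auto
  have "(LINT u|lborel. K (u / x) * w u) = (LINT u:{x..<x'} \<union> {x'..}|lborel. K (u / x) * w u)"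
    unfolding set_lebesgue_integral_def using x
    by (intro Bochner_Integration.integral_cong) (auto simp: indicator_def K_eq_0)
  also have "\<dots> = (LINT u:{x..<x'}|lborel. K (u / x) * w u) + (LINT u:{x'..}|lborel. K (u / x) * w u)"
    by (intro set_integral_Un si) auto
  finally have split: "(LINT u|lborel. K (u / x) * w u) =
     (LINT u:{x..<x'}|lborel. K (u / x) * w u) + (LINT u:{x'..}|lborel. K (u / x) * w u)" .
  have "0 \<le> (LINT u:{x'..}|lborel. K (u / x) * w u)"
  proof (cases "b * x \<le> us")
    case True
    \<comment> \<open>Here the weight \<open>K (u / x)\<close> dies out before \<open>w\<close> can
      become negative.\<close>
    have "0 \<le> K (u / x) * w u" if "x' \<le> u" for u
    proof (cases "u < us")
      case True
      then show ?thesis using pos[of u] that x K_nonneg by simp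
    next
      case False
      then show ?thesis using \<open>b * x \<le> us\<close> K_eq_0[of "u / x"] x by (simp add: field_simps)
    qed
    then show ?thesis unfolding set_lebesgue_integral_def
      by (intro integral_nonneg_AE) (auto simp: indicator_def)
  next
    case False
    let ?c = "K (us / x')" and ?d = "K (us / x)"
    have "us < b * x'" using False x b_gt_1 by (smt (verit) mult_left_mono)
    then have c: "0 < ?c" using x us by (intro K_pos) (auto simp: field_simps)
    have d: "0 \<le> ?d" by (rule K_nonneg)
    \<comment> \<open>The comparison of kernel ratios, cross-multiplied because both kernels vanish
      far out. At \<open>us\<close> both the ratio inequality and the sign of \<open>w\<close> turn
      round, so the product inequality has one direction throughout.\<close>
    have le: "?d * (K (u / x') * w u) \<le> indicator {x'..} u * (?c * (K (u / x) * w u))" for u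
    proof -
      consider "u < x'" | "x' \<le> u" "u < us" | "u = us" | "us < u" "u \<le> b * x'" | "b * x' < u"
        by linarith
      then show ?thesis
      proof cases
        case 1
        then show ?thesis using x K_eq_0[of "u / x'"] by simp
      next
        case 2
        then have "?d * K (u / x') \<le> ?c * K (u / x)"
          using K_tp2[of x x' u us] x by (simp add: mult.commute)
        then have "?d * K (u / x') * w u \<le> ?c * K (u / x) * w u"
          using pos[of u] 2 x by (intro mult_right_mono) auto
        then show ?thesis using 2 by (simp add: mult.assoc)
      next
        case 3
        then show ?thesis using us by simp
      next
        case 4
        then have "?c * K (u / x) \<le> ?d * K (u / x')"
          using K_tp2[of x x' us u] x by (simp add: mult.commute)
        then have "?d * K (u / x') * w u \<le> ?c * K (u / x) * w u"
          using neg[of u] 4 by (intro mult_right_mono_neg) auto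
        then show ?thesis using 4 us by (simp add: mult.assoc)
      next
        case 5
        moreover have "b * x \<le> b * x'" using x b_gt_1 by simp
        ultimately have "K (u / x) = 0" "K (u / x') = 0"
          using x by (auto intro!: K_eq_0 simp: field_simps)
        then show ?thesis by simp
      qed
    qed
    have "0 \<le> ?d * (LINT u|lborel. K (u / x') * w u)" using avg d by simp
    also have "\<dots> = (LINT u|lborel. ?d * (K (u / x') * w u))" by simp
    also have "\<dots> \<le> (LINT u|lborel. indicator {x'..} u * (?c * (K (u / x) * w u)))"
    proof (intro integral_mono le)
      show "integrable lborel (\<lambda>u. indicator {x'..} u * (?c * (K (u / x) * w u)))"
        using integrable_mult_right[OF si(2)[unfolded set_integrable_def], of ?c]
        by (simp add: mult.left_commute)
    qed (use i in auto)
    also have "\<dots> = ?c * (LINT u:{x'..}|lborel. K (u / x) * w u)"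
      unfolding set_lebesgue_integral_def
      by (subst integral_mult_right_zero[symmetric]) (simp add: mult_ac)
    finally show ?thesis using c by (simp add: zero_le_mult_iff)
  qed
  then show ?thesis using split by simp
qed

text \<open>\<open>R\<close> is chosen so that \<open>\<phi> (\<rho> * u) - R * \<phi> u\<close> has
  average zero under the weight \<open>K (u / x')\<close>. Log-concavity of \<open>\<phi>\<close>
  lets this difference change sign only once, from plus to minus, so \<open>threshold\<close>
  applies at \<open>x\<close>. The integral over \<open>[x, x')\<close> is kept as an explicit
  remainder: its sign gives log-concavity of \<open>T \<phi>\<close>, and its strict positivity
  later gives the strict version for \<open>f\<close>.\<close>

lemma T_ratio:
  assumes int: "integrable lborel \<phi>" and pos: "\<And>u. 0 < u \<Longrightarrow> 0 < \<phi> u" and zero: "\<And>u. u \<le> 0 \<Longrightarrow> \<phi> u = 0"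
    and lc: "mult_log_concave \<phi>" and x: "0 < x" "x \<le> x'" and \<rho>: "1 \<le> \<rho>"
  defines "R \<equiv> T \<phi> (\<rho> * x') / (\<rho> * T \<phi> x')"
  shows "(LINT u:{x..<x'}|lborel. K (u / x) * (\<phi> (\<rho> * u) - R * \<phi> u)) \<le> T \<phi> (\<rho> * x) / \<rho> - R * T \<phi> x"
    and "R * \<phi> x' \<le> \<phi> (\<rho> * x')"
proof -
  define w where "w u = \<phi> (\<rho> * u) - R * \<phi> u" for u
  have nn: "0 \<le> \<phi> u" for u using pos[of u] zero[of u] by fastforce
  have int\<rho>: "integrable lborel (\<lambda>u. \<phi> (\<rho> * u))"
    using lborel_integrable_real_affine[OF int, of \<rho> 0] \<rho> by simp
  have intw: "integrable lborel w" unfolding w_def using int int\<rho> by auto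
  have Tp: "0 < T \<phi> y" if "0 < y" for y
    using that integral_K_pos[OF int that, of "y + 1"] nn pos by (auto simp: T_def)
  have Kw: "(LINT u|lborel. K (u / y) * w u) = T \<phi> (\<rho> * y) / \<rho> - R * T \<phi> y" if "0 < y" for y
  proof -
    have "(LINT u|lborel. K (u / y) * w u) = (LINT u|lborel. K (u / y) * \<phi> (\<rho> * u) - R * (K (u / y) * \<phi> u))"
      by (simp add: w_def algebra_simps)
    also have "\<dots> = (LINT u|lborel. K (u / y) * \<phi> (\<rho> * u)) - (LINT u|lborel. R * (K (u / y) * \<phi> u))"
      by (intro Bochner_Integration.integral_diff integrable_mult_right integrable_K_mult int int\<rho>)
    also have "\<dots> = T \<phi> (\<rho> * y) / \<rho> - R * T \<phi> y"
      using T_scale[of y \<rho> \<phi>] that \<rho> by (simp add: T_def)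
    finally show ?thesis .
  qed
  have x': "0 < x'" using x by simp
  have avg: "(LINT u|lborel. K (u / x') * w u) = 0"
    using Kw[OF x'] Tp[OF x'] \<rho> by (simp add: R_def)
  have lc': "\<phi> u * \<phi> (\<rho> * v) \<le> \<phi> (\<rho> * u) * \<phi> v" if "0 < u" "u \<le> v" for u v
    using mult_log_concaveD[OF lc that \<rho>] .
  \<comment> \<open>The set where \<open>w\<close> is nonnegative is an initial segment of the
    half-line.\<close>
  have down: "0 \<le> w u" if "0 \<le> w v" "0 < u" "u \<le> v" for u v
  proof -
    have "R * \<phi> u * \<phi> v \<le> \<phi> (\<rho> * v) * \<phi> u" using that(1) nn[of u]
      by (metis diff_ge_0_iff_ge mult.assoc mult.commute mult_right_mono w_def)
    also have "\<dots> \<le> \<phi> (\<rho> * u) * \<phi> v" using lc'[OF that(2,3)] by (simp add: mult.commute)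
    finally show ?thesis using pos[of v] that by (simp add: w_def)
  qed
  \<comment> \<open>Averaging log-concavity at the pair \<open>x'\<close>, \<open>u\<close> over
    \<open>u \<ge> x'\<close> shows that \<open>w\<close> is nonnegative at \<open>x'\<close>; the
    sign change therefore lies to the right of \<open>x'\<close>.\<close>
  have "\<phi> x' * (T \<phi> (\<rho> * x') / \<rho>) \<le> \<phi> (\<rho> * x') * T \<phi> x'"
  proof -
    have "\<phi> x' * (LINT u|lborel. K (u / x') * \<phi> (\<rho> * u)) = (LINT u|lborel. \<phi> x' * (K (u / x') * \<phi> (\<rho> * u)))"
      by simp
    also have "\<dots> \<le> (LINT u|lborel. \<phi> (\<rho> * x') * (K (u / x') * \<phi> u))"
    proof (intro integral_mono integrable_mult_right integrable_K_mult int int\<rho>)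
      fix u
      show "\<phi> x' * (K (u / x') * \<phi> (\<rho> * u)) \<le> \<phi> (\<rho> * x') * (K (u / x') * \<phi> u)"
      proof (cases "x' \<le> u")
        case True
        then have "K (u / x') * (\<phi> x' * \<phi> (\<rho> * u)) \<le> K (u / x') * (\<phi> (\<rho> * x') * \<phi> u)"
          using lc'[OF x' True] K_nonneg by (intro mult_left_mono) auto
        then show ?thesis by (simp add: mult_ac)
      next
        case False
        then show ?thesis using x' K_eq_0[of "u / x'"] by simp
      qed
    qed
    also have "\<dots> = \<phi> (\<rho> * x') * T \<phi> x'" using x' by (simp add: T_def)
    finally show ?thesis using T_scale[OF x', of \<rho> \<phi>] \<rho> by simp
  qed
  then show Rx': "R * \<phi> x' \<le> \<phi> (\<rho> * x')"
    using Tp[OF x'] \<rho> by (simp add: R_def field_simps)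
  \<comment> \<open>The sign change is taken as a supremum, since \<open>\<phi>\<close> need not be
    continuous and \<open>w\<close> need not have a zero. The cap \<open>b * x'\<close> is the point
    where the weight \<open>K (u / x')\<close> ends.\<close>
  define S where "S = {u. x' \<le> u \<and> u \<le> b * x' \<and> 0 \<le> w u}"
  have S: "x' \<in> S" "bdd_above S"
    using Rx' b_gt_1 x' by (auto simp: S_def w_def intro!: bdd_aboveI[of _ "b * x'"])
  have us: "x' \<le> Sup S" "Sup S \<le> b * x'"
    using S by (auto simp: S_def intro!: cSup_upper cSup_least)
  have "(LINT u:{x..<x'}|lborel. K (u / x) * w u) \<le> (LINT u|lborel. K (u / x) * w u)"
  proof (rule threshold[OF intw x us])
    fix u assume "x \<le> u" "u < Sup S"
    then obtain v where "v \<in> S" "u < v" using S less_cSupD[of S u] by blast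
    then show "0 \<le> w u" using down[of v u] \<open>x \<le> u\<close> x by (auto simp: S_def)
  next
    fix u assume u: "Sup S < u" "u \<le> b * x'"
    then have "u \<notin> S" using cSup_upper[OF _ S(2), of u] by auto
    then show "w u \<le> 0" using u us by (auto simp: S_def)
  qed (simp add: avg)
  then show "(LINT u:{x..<x'}|lborel. K (u / x) * (\<phi> (\<rho> * u) - R * \<phi> u)) \<le> T \<phi> (\<rho> * x) / \<rho> - R * T \<phi> x"
    using Kw[OF x(1)] by (simp add: w_def)
qed

end

section \<open>Moments and tails of a fixed point\<close>

locale kernel_density = log_concave_kernel +
  fixes f :: "real \<Rightarrow> real"
  assumes f_borel [measurable]: "f \<in> borel_measurable borel"
    and f_nonneg: "0 \<le> f x"
    and f_eq_0: "x \<le> 0 \<Longrightarrow> f x = 0"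
    and f_int: "integrable lborel f"
    and f_mass: "0 < (LINT x|lborel. f x)"
    and f_eq: "0 < x \<Longrightarrow> f x = (LINT u|lborel. K (u / x) * f u)"
begin

lemma f_eq_T: "f = T f"
  using f_eq f_eq_0 by (auto simp: T_def fun_eq_iff)

lemma K_mult_f_eq_0: "x \<le> 0 \<Longrightarrow> K (u / x) * f u = 0"
proof (cases "0 < u")
  case True
  assume "x \<le> 0"
  then have "u / x \<le> 0" using True by (simp add: divide_nonneg_nonpos)
  then show ?thesis using K_eq_0[of "u / x"] by simp
qed (simp add: f_eq_0)

lemma f_eq_nn: "ennreal (f x) = (\<integral>\<^sup>+u. ennreal (K (u / x) * f u) \<partial>lborel)"
proof (cases "0 < x")
  case True
  then show ?thesis
    using nn_integral_eq_integral[OF integrable_K_mult[OF f_int, of x]] K_nonneg f_nonneg f_eq by simp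
qed (simp add: K_mult_f_eq_0 f_eq_0)

section \<open>Moments and their recursion\<close>

definition moment :: "nat \<Rightarrow> real" where "moment n = (LINT x|lborel. x ^ n * f x)"

text \<open>A Mellin transform of \<open>K\<close>, taken in \<open>s = 1 / t\<close>. For
  \<open>K t = t powr (- \<beta>)\<close> on \<open>t \<ge> 1\<close> its value would be
  \<open>1 / (real n + \<beta> + 1)\<close>, and the recursion below would be that of the Gamma
  function.\<close>

definition kmoment :: "nat \<Rightarrow> real" where "kmoment n = (LINT s|lborel. s ^ n * K (1 / s))"

lemma K_inverse_eq_0: "s \<le> 0 \<Longrightarrow> K (1 / s) = 0"
  by (rule K_eq_0, rule disjI1, rule le_less_trans[of _ 0]) (auto simp: divide_nonneg_nonpos)

lemma kmoment_integrand_nonneg: "0 \<le> s ^ n * K (1 / s)"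
proof (cases "0 < s")
  case False
  then show ?thesis using K_inverse_eq_0[of s] by simp
qed (simp add: K_nonneg)

lemma kmoment_borel: "(\<lambda>s. s ^ n * K (1 / s)) \<in> borel_measurable borel"
  by measurable

lemma kmoment_integrable: "integrable lborel (\<lambda>s. s ^ n * K (1 / s))"
proof (rule Bochner_Integration.integrable_bound)
  show "integrable lborel (indicator {0..1::real} :: real \<Rightarrow> real)" by simp
  show "AE s in lborel. norm (s ^ n * K (1 / s)) \<le> norm (indicator {0..1} s :: real)"
  proof (intro AE_I2)
    fix s :: real
    consider "s \<le> 0" | "0 < s" "s \<le> 1" | "1 < s" by linarith
    then show "norm (s ^ n * K (1 / s)) \<le> norm (indicator {0..1} s :: real)"
    proof cases
      case 1
      then show ?thesis using K_inverse_eq_0[of s] by simp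
    next
      case 2
      then have "s ^ n * K (1 / s) \<le> 1 * 1"
        using K_le_1 K_nonneg by (intro mult_mono power_le_one) auto
      then show ?thesis using 2 K_nonneg by (simp add: abs_mult)
    next
      case 3
      then show ?thesis using K_eq_0[of "1 / s"] by simp
    qed
  qed
qed (use kmoment_borel in simp)

lemma kmoment_pos: "0 < kmoment n"
  unfolding kmoment_def
proof (rule integral_pos_interval[OF kmoment_integrable kmoment_integrand_nonneg])
  show "1 / b < 1" using b_gt_1 by simp
  show "0 < s ^ n * K (1 / s)" if "1 / b < s" "s < 1" for s
  proof -
    have "0 < 1 / b" using b_gt_1 by simp
    with that have "0 < s" by linarith
    then show ?thesis using that b_gt_1 by (intro mult_pos_pos K_pos) (auto simp: field_simps)
  qed
qed

text \<open>Tonelli and the substitution \<open>x = u * s\<close>. The integrals are taken in the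
  extended nonnegative reals because no moment is known to be finite yet.\<close>

lemma nn_moment_rec:
  "(\<integral>\<^sup>+x. ennreal (x ^ n * f x) \<partial>lborel) = ennreal (kmoment n) * (\<integral>\<^sup>+x. ennreal (x ^ Suc n * f x) \<partial>lborel)"
proof -
  have "(\<integral>\<^sup>+x. ennreal (x ^ n * f x) \<partial>lborel) = (\<integral>\<^sup>+x. \<integral>\<^sup>+u. ennreal (x ^ n * (K (u / x) * f u)) \<partial>lborel \<partial>lborel)"
  proof (rule nn_integral_cong)
    fix x :: real
    show "ennreal (x ^ n * f x) = (\<integral>\<^sup>+u. ennreal (x ^ n * (K (u / x) * f u)) \<partial>lborel)"
    proof (cases "0 < x")
      case True
      then have "(\<integral>\<^sup>+u. ennreal (x ^ n * (K (u / x) * f u)) \<partial>lborel) = ennreal (x ^ n) * ennreal (f x)"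
        by (simp add: ennreal_mult' nn_integral_cmult f_eq_nn)
      then show ?thesis using True by (simp add: ennreal_mult')
    qed (simp add: K_mult_f_eq_0 f_eq_0)
  qed
  also have "\<dots> = (\<integral>\<^sup>+u. \<integral>\<^sup>+x. ennreal (x ^ n * (K (u / x) * f u)) \<partial>lborel \<partial>lborel)"
    by (rule lborel_pair.Fubini') simp
  also have "\<dots> = (\<integral>\<^sup>+u. ennreal (kmoment n) * ennreal (u ^ Suc n * f u) \<partial>lborel)"
  proof (rule nn_integral_cong)
    fix u :: real
    show "(\<integral>\<^sup>+x. ennreal (x ^ n * (K (u / x) * f u)) \<partial>lborel) = ennreal (kmoment n) * ennreal (u ^ Suc n * f u)"
    proof (cases "0 < u")
      case True
      have "(\<integral>\<^sup>+x. ennreal (x ^ n * (K (u / x) * f u)) \<partial>lborel)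
          = ennreal u * (\<integral>\<^sup>+s. ennreal ((u * s) ^ n * (K (u / (u * s)) * f u)) \<partial>lborel)"
        using True nn_integral_real_affine[of "\<lambda>x. ennreal (x ^ n * (K (u / x) * f u))" u 0] by simp
      also have "\<dots> = ennreal u * (\<integral>\<^sup>+s. ennreal (u ^ n * f u) * ennreal (s ^ n * K (1 / s)) \<partial>lborel)"
        using True f_nonneg
        by (subst ennreal_mult'[symmetric]) (auto simp: power_mult_distrib mult_ac)
      also have "\<dots> = ennreal u * (ennreal (u ^ n * f u) * ennreal (kmoment n))"
        unfolding kmoment_def using kmoment_integrand_nonneg
        by (simp add: nn_integral_cmult nn_integral_eq_integral[OF kmoment_integrable])
      also have "\<dots> = ennreal (kmoment n) * ennreal (u ^ Suc n * f u)"
        using True f_nonneg kmoment_pos[of n]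
        by (simp add: ennreal_mult'[symmetric] mult_ac)
      finally show ?thesis .
    qed (simp add: f_eq_0)
  qed
  also have "\<dots> = ennreal (kmoment n) * (\<integral>\<^sup>+x. ennreal (x ^ Suc n * f x) \<partial>lborel)"
    by (rule nn_integral_cmult) simp
  finally show ?thesis .
qed

lemma power_mult_f_nonneg: "0 \<le> x ^ n * f x"
  by (cases "0 < x") (auto simp: f_eq_0 f_nonneg)

text \<open>The recursion is read upwards: a finite moment equals a positive constant times the next
  one, which is therefore finite as well.\<close>

lemma moment_integrable: "integrable lborel (\<lambda>x. x ^ n * f x)"
proof (induction n)
  case 0
  show ?case using f_int by simp
next
  case (Suc n)
  have "(\<integral>\<^sup>+x. ennreal (x ^ n * f x) \<partial>lborel) < \<infinity>"
    using nn_integral_eq_integral[OF Suc] power_mult_f_nonneg by simp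
  then have "(\<integral>\<^sup>+x. ennreal (x ^ Suc n * f x) \<partial>lborel) < \<infinity>"
    using kmoment_pos[of n] by (subst (asm) nn_moment_rec) (auto simp: ennreal_mult_less_top)
  then show ?case
    by (intro integrableI_nonneg) (auto intro: power_mult_f_nonneg simp del: power_Suc)
qed

lemma moment_nonneg: "0 \<le> moment n"
  unfolding moment_def by (intro Bochner_Integration.integral_nonneg power_mult_f_nonneg)

lemma nn_moment: "(\<integral>\<^sup>+x. ennreal (x ^ n * f x) \<partial>lborel) = ennreal (moment n)"
  unfolding moment_def by (intro nn_integral_eq_integral moment_integrable AE_I2 power_mult_f_nonneg)

lemma moment_rec: "moment n = kmoment n * moment (Suc n)"
proof -
  have "ennreal (moment n) = ennreal (kmoment n * moment (Suc n))"
    using nn_moment_rec[of n] kmoment_pos[of n] by (simp add: nn_moment ennreal_mult' less_imp_le del: power_Suc)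
  then show ?thesis using moment_nonneg[of n] moment_nonneg[of "Suc n"] kmoment_pos[of n] by simp
qed

text \<open>With \<open>s = 1 / t\<close> the lower bound on \<open>K\<close> reads
  \<open>s powr (- 1 + p) * (1 - C * (1 - s)^2)\<close> after multiplication by
  \<open>s ^ n\<close>. The Beta integral of the quadratic term is
  \<open>2 / (p * (p + 1) * (p + 2))\<close>, a relative error of order
  \<open>1 / n^2\<close>.\<close>

lemma kmoment_lower:
  fixes n :: nat
  defines "p \<equiv> real n + \<beta> + 1"
  shows "(1 - 2 * C / ((p + 1) * (p + 2))) / p \<le> kmoment n"
proof -
  define G where "G s = (1 - C) * s powr (p - 1) + 2 * C * s powr p - C * s powr (p + 1)" for s
  have p: "p > 1" using \<beta>_pos by (simp add: p_def)
  have hi: "(G has_integral (1 - C) * (1 / p) + 2 * C * (1 / (p + 1)) - C * (1 / (p + 2))) {0..1}"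
    unfolding G_def
  proof (intro has_integral_diff has_integral_add has_integral_mult_right)
    show "((\<lambda>s. s powr (p - 1)) has_integral 1 / p) {0..1}"
      using has_integral_powr_from_0[of "p - 1" 1] p by simp
    show "((\<lambda>s. s powr p) has_integral 1 / (p + 1)) {0..1}"
      using has_integral_powr_from_0[of p 1] p by simp
    show "((\<lambda>s. s powr (p + 1)) has_integral 1 / (p + 2)) {0..1}"
      using has_integral_powr_from_0[of "p + 1" 1] p by (simp add: add.assoc)
  qed
  have cont: "continuous_on {0..1} G"
    unfolding G_def using p
    by (intro continuous_on_add continuous_on_diff continuous_on_mult continuous_on_const
        continuous_on_powr' continuous_on_id) auto
  have si: "set_integrable lborel {0..1} G"
    by (rule borel_integrable_atLeastAtMost'[OF cont])
  have eq: "(LINT s:{0..1}|lborel. G s) = (1 - C) * (1 / p) + 2 * C * (1 / (p + 1)) - C * (1 / (p + 2))"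
    using set_borel_integral_eq_integral(2)[OF si] integral_unique[OF hi] by simp
  have "(LINT s:{0..1}|lborel. G s) \<le> kmoment n"
    unfolding kmoment_def set_lebesgue_integral_def
  proof (rule integral_mono)
    show "integrable lborel (\<lambda>s. indicator {0..1} s *\<^sub>R G s)"
      using si by (simp add: set_integrable_def)
    show "indicator {0..1} s *\<^sub>R G s \<le> s ^ n * K (1 / s)" for s
    proof (cases "0 < s \<and> s \<le> 1")
      case True
      then have s: "0 < s" "s \<le> 1" by auto
      have "G s = s powr (p - 1) * (1 - C * (1 - s)\<^sup>2)"
        using s by (simp add: G_def powr_add powr_diff power2_eq_square field_simps)
      also have "s powr (p - 1) = s ^ n * (1 / s) powr (- \<beta>)"
        using s by (simp add: p_def powr_add powr_realpow powr_minus powr_divide divide_simps)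
      also have "s ^ n * (1 / s) powr (- \<beta>) * (1 - C * (1 - s)\<^sup>2) \<le> s ^ n * K (1 / s)"
        using K_lower[of "1 / s"] s by (simp add: mult.assoc)
      finally show ?thesis using s by simp
    next
      case False
      moreover have "G 0 = 0" using p by (simp add: G_def)
      ultimately show ?thesis using kmoment_integrand_nonneg[of s n]
        by (cases "s = 0") (auto simp: indicator_def)
    qed
  qed (rule kmoment_integrable)
  moreover have "(1 - C) * (1 / p) + 2 * C * (1 / (p + 1)) - C * (1 / (p + 2)) = (1 - 2 * C / ((p + 1) * (p + 2))) / p"
    using p by (simp add: divide_simps) algebra
  ultimately show ?thesis using eq by simp
qed

text \<open>The relative errors of the successive steps are summable, so the moments stay within a
  constant factor of the Gamma values. The start at \<open>4 * C\<close> guarantees an error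
  \<open>y \<le> 1 / 2\<close>, which is what \<open>1 \<le> (1 - y) * exp (2 * y)\<close> is
  derived from.\<close>

lemma moment_bound: "\<exists>A. \<forall>n\<ge>nat \<lceil>4 * C\<rceil>. moment n \<le> A * Gamma (real n + \<beta> + 1)"
proof -
  define p where "p n = real n + \<beta> + 1" for n
  \<comment> \<open>The step loses at most \<open>exp (4 * C / ((p n + 1) * (p n + 2)))\<close>, which telescopes.\<close>
  define a where "a n = moment n / Gamma (p n) * exp (4 * C / (p n + 1))" for n
  have p: "p n > 1" for n using \<beta>_pos by (simp add: p_def)
  have G: "Gamma (p n) > 0" for n using p[of n] by (intro Gamma_real_pos) auto
  have step: "a (Suc n) \<le> a n" if n: "4 * C \<le> real n" for n
  proof -
    define y where "y = 2 * C / ((p n + 1) * (p n + 2))"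
    have "4 * C \<le> (p n + 1) * (p n + 2)"
    proof -
      have "4 * C \<le> (p n + 1) * 1" using n \<beta>_pos by (simp add: p_def)
      also have "\<dots> \<le> (p n + 1) * (p n + 2)" using p[of n] by (intro mult_left_mono) auto
      finally show ?thesis .
    qed
    then have y: "0 \<le> y" "y \<le> 1 / 2"
      using p[of n] C_nonneg by (auto simp: y_def divide_simps)
    have "1 \<le> (1 - y) * (1 + 2 * y)" using y mult_left_mono[of y "1/2" y] by (simp add: algebra_simps)
    also have "\<dots> \<le> (1 - y) * exp (2 * y)" using y by (intro mult_left_mono) auto
    finally have e: "1 \<le> (1 - y) * exp (2 * y)" .
    have "moment (Suc n) * 1 \<le> moment (Suc n) * ((1 - y) * exp (2 * y))"
      by (intro mult_left_mono e moment_nonneg)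
    also have "\<dots> = (1 - y) / p n * moment (Suc n) * (p n * exp (2 * y))" using p[of n] by simp
    also have "\<dots> \<le> moment n * (p n * exp (2 * y))"
      unfolding moment_rec[of n] using kmoment_lower[of n] moment_nonneg p[of n]
      by (intro mult_right_mono) (auto simp: p_def y_def)
    finally have m: "moment (Suc n) \<le> moment n * (p n * exp (2 * y))" by simp
    have pS: "p (Suc n) = p n + 1" by (simp add: p_def)
    have GS: "Gamma (p (Suc n)) = p n * Gamma (p n)"
      unfolding pS using p[of n] by (intro Gamma_plus1) (auto dest: nonpos_Ints_nonpos)
    have ee: "2 * y + 4 * C / (p n + 2) = 4 * C / (p n + 1)"
      using p[of n] by (simp add: y_def divide_simps) algebra
    have "a (Suc n) = moment (Suc n) * exp (4 * C / (p n + 2)) / (p n * Gamma (p n))"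
      unfolding a_def GS by (simp add: pS add.commute)
    also have "\<dots> \<le> moment n * (p n * exp (2 * y)) * exp (4 * C / (p n + 2)) / (p n * Gamma (p n))"
      using m p[of n] G[of n] by (intro divide_right_mono mult_right_mono) auto
    also have "\<dots> = moment n * exp (2 * y + 4 * C / (p n + 2)) / Gamma (p n)"
      using p[of n] by (simp add: exp_add)
    also have "\<dots> = a n" unfolding ee by (simp add: a_def)
    finally show ?thesis .
  qed
  define n0 where "n0 = nat \<lceil>4 * C\<rceil>"
  have n0: "4 * C \<le> real n" if "n0 \<le> n" for n using that unfolding n0_def by linarith
  have "a n \<le> a n0" if "n0 \<le> n" for n
    using that by (induction n rule: dec_induct) (use step n0 in \<open>auto intro: order_trans\<close>)
  moreover have "moment n \<le> a n * Gamma (p n)" for n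
  proof -
    have "0 \<le> 4 * C / (p n + 1)" using C_nonneg p[of n] by simp
    then have "moment n * 1 \<le> moment n * exp (4 * C / (p n + 1))"
      by (intro mult_left_mono moment_nonneg) simp
    then show ?thesis using G[of n] by (simp add: a_def)
  qed
  ultimately have "moment n \<le> a n0 * Gamma (p n)" if "n0 \<le> n" for n
    using that G[of n] by (meson mult_right_mono less_imp_le order_trans)
  then show ?thesis unfolding p_def n0_def by blast
qed

section \<open>The weighted tail of the fixed point\<close>

definition N :: "real \<Rightarrow> real" where "N x = (LINT u:{x..}|lborel. u powr (- \<beta>) * f u)"

lemma N_set_integrable:
  assumes "0 < x" and "A \<in> sets borel" "A \<subseteq> {x..}"
  shows "set_integrable lborel A (\<lambda>u. u powr (- \<beta>) * f u)"
  unfolding set_integrable_def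
proof (rule Bochner_Integration.integrable_bound)
  show "integrable lborel (\<lambda>u. x powr (- \<beta>) * f u)" using f_int by simp
  show "AE u in lborel. norm (indicator A u *\<^sub>R (u powr (- \<beta>) * f u)) \<le> norm (x powr (- \<beta>) * f u)"
  proof (intro AE_I2)
    fix u
    have "u powr (- \<beta>) \<le> x powr (- \<beta>)" if "x \<le> u"
      using that assms(1) \<beta>_pos by (intro powr_mono2') auto
    then show "norm (indicator A u *\<^sub>R (u powr (- \<beta>) * f u)) \<le> norm (x powr (- \<beta>) * f u)"
      using assms(3) f_nonneg by (auto simp: indicator_def abs_mult intro!: mult_right_mono)
  qed
qed (use assms in simp)

lemma N_nonneg: "0 \<le> N x"
  unfolding N_def set_lebesgue_integral_def using f_nonneg
  by (intro Bochner_Integration.integral_nonneg) auto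

text \<open>For the exact power kernel this would be an equality; then \<open>N' = - N\<close>, and
  \<open>exp x * N x\<close> would be constant. The one-sided bound on \<open>K\<close> leaves
  \<open>- N' \<le> N\<close>, so \<open>exp x * N x\<close> still increases.\<close>

lemma f_le_N: assumes "0 < x" shows "f x \<le> x powr \<beta> * N x"
proof -
  have "f x = (LINT u|lborel. K (u / x) * f u)" by (rule f_eq[OF assms])
  also have "\<dots> \<le> (LINT u|lborel. x powr \<beta> * (indicator {x..} u *\<^sub>R (u powr (- \<beta>) * f u)))"
  proof (intro integral_mono integrable_K_mult f_int integrable_mult_right)
    show "integrable lborel (\<lambda>u. indicator {x..} u *\<^sub>R (u powr (- \<beta>) * f u))"
      using N_set_integrable[OF assms, of "{x..}"] by (simp add: set_integrable_def)
    fix u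
    show "K (u / x) * f u \<le> x powr \<beta> * (indicator {x..} u *\<^sub>R (u powr (- \<beta>) * f u))"
    proof (cases "x \<le> u")
      case True
      have "K (u / x) * f u \<le> (u / x) powr (- \<beta>) * f u"
        using True assms by (intro mult_right_mono K_upper f_nonneg) simp
      also have "\<dots> = x powr \<beta> * (u powr (- \<beta>) * f u)"
        using True assms by (simp add: powr_divide powr_minus field_simps)
      finally show ?thesis using True by simp
    next
      case False
      then show ?thesis using assms K_eq_0[of "u / x"] by simp
    qed
  qed
  also have "\<dots> = x powr \<beta> * N x"
    unfolding N_def set_lebesgue_integral_def by (rule integral_mult_right_zero)
  finally show ?thesis .
qed

lemma N_split:
  assumes "0 < x" "x \<le> y"
  shows "N x = (LINT u:{x..<y}|lborel. u powr (- \<beta>) * f u) + N y"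
proof -
  have "{x..} = {x..<y} \<union> {y..}" using assms by auto
  moreover have "(LINT u:{x..<y} \<union> {y..}|lborel. u powr (- \<beta>) * f u) =
      (LINT u:{x..<y}|lborel. u powr (- \<beta>) * f u) + (LINT u:{y..}|lborel. u powr (- \<beta>) * f u)"
    by (rule set_integral_Un) (use assms in \<open>auto intro!: N_set_integrable[OF assms(1)]\<close>)
  ultimately show ?thesis unfolding N_def by simp
qed

lemma N_antimono: assumes "0 < x" "x \<le> y" shows "N y \<le> N x"
proof -
  have "0 \<le> (LINT u:{x..<y}|lborel. u powr (- \<beta>) * f u)"
    unfolding set_lebesgue_integral_def using f_nonneg
    by (intro Bochner_Integration.integral_nonneg) auto
  then show ?thesis using N_split[OF assms] by simp
qed

lemma N_step: assumes "0 < x" "0 \<le> d" shows "(1 - d) * N x \<le> N (x + d)"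
proof -
  have "(LINT u:{x..<x + d}|lborel. u powr (- \<beta>) * f u) \<le> (LINT u:{x..<x + d}|lborel. N x)"
  proof (rule set_integral_mono)
    show "set_integrable lborel {x..<x + d} (\<lambda>u. u powr (- \<beta>) * f u)"
      by (rule N_set_integrable[OF assms(1)]) auto
    show "set_integrable lborel {x..<x + d} (\<lambda>u. N x)" 
      using assms by (auto simp: set_integrable_def intro!: integrable_real_indicator)
    fix u assume "u \<in> {x..<x + d}"
    then have u: "0 < u" "x \<le> u" using assms by auto
    have "u powr (- \<beta>) * f u \<le> N u"
      using f_le_N[OF u(1)] u(1) by (simp add: powr_minus divide_simps mult.commute)
    also have "\<dots> \<le> N x" using N_antimono assms u by simp
    finally show "u powr (- \<beta>) * f u \<le> N x" .
  qed
  also have "\<dots> = d * N x" using assms by (simp add: set_lebesgue_integral_def)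
  finally show ?thesis using N_split[OF assms(1), of "x + d"] assms by (simp add: algebra_simps)
qed

text \<open>Integrated form of \<open>- N' \<le> N\<close>; iterating the one-step bound avoids derivatives.\<close>
lemma exp_N_le: assumes "0 < x" "x \<le> y" shows "exp (x - y) * N x \<le> N y"
proof (rule LIMSEQ_le_const2)
  show "(\<lambda>n. (1 + (x - y) / real n) ^ n * N x) \<longlonglongrightarrow> exp (x - y) * N x"
    by (intro tendsto_mult tendsto_exp_limit_sequentially tendsto_const)
  \<comment> \<open>For such \<open>n\<close> the step length is at most \<open>1\<close>, so
    \<open>1 - d\<close> is nonnegative and the one-step inequality may be multiplied by it.\<close>
  have "(1 + (x - y) / real n) ^ n * N x \<le> N y" if n: "nat \<lceil>y - x\<rceil> + 1 \<le> n" for n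
  proof -
    define d where "d = (y - x) / real n"
    have "n > 0" "y - x \<le> real n" using n by linarith+
    then have d: "0 \<le> d" "d \<le> 1" using assms by (auto simp: d_def divide_simps)
    have "(1 - d) ^ k * N x \<le> N (x + real k * d)" for k
    proof (induction k)
      case (Suc k)
      have "(1 - d) ^ Suc k * N x = (1 - d) * ((1 - d) ^ k * N x)" by simp
      also have "\<dots> \<le> (1 - d) * N (x + real k * d)" using Suc d by (intro mult_left_mono) auto
      also have "\<dots> \<le> N (x + real k * d + d)"
        using assms d by (intro N_step add_pos_nonneg) auto
      finally show ?case by (simp add: algebra_simps)
    qed simp
    from this[of n] show ?thesis using \<open>n > 0\<close> by (simp add: d_def diff_divide_distrib add_diff_eq algebra_simps)
  qed
  then show "\<exists>n0. \<forall>n\<ge>n0. (1 + (x - y) / real n) ^ n * N x \<le> N y" by blast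
qed

lemma nn_N: "0 < x \<Longrightarrow> ennreal (N x) = (\<integral>\<^sup>+u. indicator {x..} u * ennreal (u powr (- \<beta>) * f u) \<partial>lborel)"
  unfolding N_def set_lebesgue_integral_def
  by (subst nn_integral_eq_integral[symmetric])
     (use N_set_integrable[of x "{x..}"] f_nonneg in \<open>auto simp: set_integrable_def indicator_def intro!: nn_integral_cong\<close>)

text \<open>\<open>N\<close> is the tail function of the measure with density
  \<open>u powr (- \<beta>) * f u\<close>. Used with a power \<open>g\<close> to turn integrals of
  \<open>N\<close> into moments, and with \<open>g = 1\<close> to estimate the mean excess over
  \<open>a\<close>.\<close>

lemma layer_cake:
  assumes "0 \<le> a" and [measurable]: "g \<in> borel_measurable borel"
  shows "(\<integral>\<^sup>+v. indicator {a<..} v * g v * ennreal (N v) \<partial>lborel) =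
    (\<integral>\<^sup>+u. ennreal (u powr (- \<beta>) * f u) * (\<integral>\<^sup>+v. indicator {a<..u} v * g v \<partial>lborel) \<partial>lborel)"
proof -
  have "(\<integral>\<^sup>+v. indicator {a<..} v * g v * ennreal (N v) \<partial>lborel) =
    (\<integral>\<^sup>+v. \<integral>\<^sup>+u. (if a < v \<and> v \<le> u then g v * ennreal (u powr (- \<beta>) * f u) else 0) \<partial>lborel \<partial>lborel)"
  proof (rule nn_integral_cong)
    fix v
    show "indicator {a<..} v * g v * ennreal (N v) =
      (\<integral>\<^sup>+u. (if a < v \<and> v \<le> u then g v * ennreal (u powr (- \<beta>) * f u) else 0) \<partial>lborel)"
    proof (cases "a < v")
      case True
      then have "indicator {a<..} v * g v * ennreal (N v) =
          (\<integral>\<^sup>+u. g v * (indicator {v..} u * ennreal (u powr (- \<beta>) * f u)) \<partial>lborel)"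
        using assms by (simp add: nn_N nn_integral_cmult)
      then show ?thesis using True by (auto simp: indicator_def intro!: nn_integral_cong)
    qed simp
  qed
  also have "\<dots> = (\<integral>\<^sup>+u. \<integral>\<^sup>+v. (if a < v \<and> v \<le> u then g v * ennreal (u powr (- \<beta>) * f u) else 0) \<partial>lborel \<partial>lborel)"
    by (rule lborel_pair.Fubini') simp
  also have "\<dots> = (\<integral>\<^sup>+u. ennreal (u powr (- \<beta>) * f u) * (\<integral>\<^sup>+v. indicator {a<..u} v * g v \<partial>lborel) \<partial>lborel)"
    by (subst nn_integral_cmult[symmetric]) (auto simp: indicator_def mult.commute intro!: nn_integral_cong)
  finally show ?thesis .
qed

end

section \<open>Elementary estimates for powers, exponentials and Gamma\<close>

lemma nn_integral_powr:
  assumes "-1 < a" "0 \<le> u"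
  shows "(\<integral>\<^sup>+v. indicator {0<..u} v * ennreal (v powr a) \<partial>lborel) = ennreal (u powr (a + 1) / (a + 1))"
proof -
  have "(\<integral>\<^sup>+v. ennreal (v powr a) * indicator {0..u} v \<partial>lborel) = ennreal (u powr (a + 1) / (a + 1))"
    by (intro nn_integral_has_integral_lebesgue' has_integral_powr_from_0) (use assms in auto)
  moreover have "(\<integral>\<^sup>+v. indicator {0<..u} v * ennreal (v powr a) \<partial>lborel) =
      (\<integral>\<^sup>+v. ennreal (v powr a) * indicator {0..u} v \<partial>lborel)"
    by (intro nn_integral_cong) (auto simp: indicator_def)
  ultimately show ?thesis by simp
qed

lemma powr_le_exp_half:
  fixes u \<beta> :: real
  assumes "0 < u" "0 < \<beta>"
  shows "u powr \<beta> \<le> (2 * \<beta>) powr \<beta> * exp (u / 2)"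
proof -
  have "\<beta> * ln (u / (2 * \<beta>)) \<le> \<beta> * (u / (2 * \<beta>))"
    using assms ln_le_minus_one[of "u / (2 * \<beta>)"] by (intro mult_left_mono) auto
  also have "\<dots> = u / 2" using assms by simp
  finally have "(u / (2 * \<beta>)) powr \<beta> \<le> exp (u / 2)"
    using assms by (simp add: powr_def)
  then show ?thesis using assms by (simp add: powr_divide field_simps)
qed

text \<open>Gamma at \<open>real k + \<beta> + 2\<close> dominates \<open>fact k\<close> up to a
  constant, so the quotient is bounded by terms of a convergent exponential series.\<close>

lemma powr_div_Gamma_tendsto_0:
  fixes x \<beta> :: real
  assumes "0 < x" "0 < \<beta>"
  shows "(\<lambda>k. x powr (real k + \<beta> + 1) / Gamma (real k + \<beta> + 2)) \<longlonglongrightarrow> 0"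
proof (rule tendsto_sandwich[OF always_eventually always_eventually tendsto_const])
  have G: "fact k * Gamma (\<beta> + 2) \<le> Gamma (real k + \<beta> + 2)" for k
  proof (induction k)
    case (Suc k)
    have "fact (Suc k) * Gamma (\<beta> + 2) = (real k + 1) * (fact k * Gamma (\<beta> + 2))" by (simp add: algebra_simps)
    also have "\<dots> \<le> (real k + \<beta> + 2) * Gamma (real k + \<beta> + 2)"
      using assms Suc by (intro mult_mono) auto
    also have "\<dots> = Gamma (real k + \<beta> + 2 + 1)"
      using assms by (subst Gamma_plus1) (auto dest: nonpos_Ints_nonpos)
    finally show ?case by (simp add: add_ac)
  qed simp
  have G0: "0 < Gamma (\<beta> + 2)" using assms by (intro Gamma_real_pos) auto
  show "\<forall>k. 0 \<le> x powr (real k + \<beta> + 1) / Gamma (real k + \<beta> + 2)"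
    using assms by (auto intro!: divide_nonneg_nonneg less_imp_le[OF Gamma_real_pos])
  show "\<forall>k. x powr (real k + \<beta> + 1) / Gamma (real k + \<beta> + 2) \<le>
      inverse (fact k) * x ^ k * (x powr (\<beta> + 1) / Gamma (\<beta> + 2))"
  proof
    fix k
    have "x powr (real k + \<beta> + 1) / Gamma (real k + \<beta> + 2) \<le> x powr (real k + \<beta> + 1) / (fact k * Gamma (\<beta> + 2))"
      using G[of k] G0 by (intro divide_left_mono mult_pos_pos) (auto intro: order.strict_trans2[OF _ G])
    also have "\<dots> = x ^ k * x powr (\<beta> + 1) / (fact k * Gamma (\<beta> + 2))"
      using assms by (simp add: powr_add[symmetric] powr_realpow[symmetric] add_ac)
    also have "\<dots> = inverse (fact k) * x ^ k * (x powr (\<beta> + 1) / Gamma (\<beta> + 2))"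
      by (simp add: field_simps)
    finally show "x powr (real k + \<beta> + 1) / Gamma (real k + \<beta> + 2) \<le>
      inverse (fact k) * x ^ k * (x powr (\<beta> + 1) / Gamma (\<beta> + 2))" .
  qed
  show "(\<lambda>k. inverse (fact k) * x ^ k * (x powr (\<beta> + 1) / Gamma (\<beta> + 2))) \<longlonglongrightarrow> 0"
    by (rule tendsto_mult_left_zero[OF summable_LIMSEQ_zero[OF summable_exp[of x]]])
qed

section \<open>Asymptotics at infinity\<close>

context kernel_density
begin

lemma N_borel [measurable]: "N \<in> borel_measurable borel"
proof -
  have "N = (\<lambda>x. LINT u|lborel. (if x \<le> u then u powr (- \<beta>) * f u else 0))"
    unfolding N_def[abs_def] set_lebesgue_integral_def
    by (intro ext Bochner_Integration.integral_cong) (auto simp: indicator_def)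
  then show ?thesis by simp
qed

text \<open>Beyond \<open>x\<close> the function \<open>N\<close> lies above
  \<open>Q * exp (- v)\<close> with \<open>Q = exp x * N x\<close>, so a large \<open>Q\<close>
  forces large moments. The range below \<open>x\<close>, where this fails, costs only the power of
  \<open>x\<close>, which is negligible against Gamma as \<open>k\<close> grows.\<close>

lemma N_Gamma_le:
  assumes x: "0 < x"
  shows "exp x * N x * (Gamma (real k + \<beta> + 2) - x powr (real k + \<beta> + 1)) \<le> moment (Suc k)"
proof -
  \<comment> \<open>Chosen so that integrating \<open>v powr (s - 1)\<close> up to \<open>u\<close>
    and multiplying by \<open>u powr (- \<beta>)\<close> gives \<open>u ^ Suc k / s\<close>.\<close>
  define s where "s = real k + \<beta> + 1"
  have s: "1 < s" using \<beta>_pos by (simp add: s_def)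
  define Q where "Q = exp x * N x"
  have Q: "0 \<le> Q" using N_nonneg by (simp add: Q_def)
  have up: "(\<integral>\<^sup>+v. indicator {0<..} v * ennreal (v powr (s - 1)) * ennreal (N v) \<partial>lborel) = ennreal (moment (Suc k) / s)"
  proof -
    have "(\<integral>\<^sup>+v. indicator {0<..} v * ennreal (v powr (s - 1)) * ennreal (N v) \<partial>lborel)
       = (\<integral>\<^sup>+u. ennreal (u powr (- \<beta>) * f u) * (\<integral>\<^sup>+v. indicator {0<..u} v * ennreal (v powr (s - 1)) \<partial>lborel) \<partial>lborel)"
      by (rule layer_cake) auto
    also have "\<dots> = (\<integral>\<^sup>+u. ennreal (1 / s) * ennreal (u ^ Suc k * f u) \<partial>lborel)"
    proof (rule nn_integral_cong)
      fix u
      show "ennreal (u powr (- \<beta>) * f u) * (\<integral>\<^sup>+v. indicator {0<..u} v * ennreal (v powr (s - 1)) \<partial>lborel) =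
        ennreal (1 / s) * ennreal (u ^ Suc k * f u)"
      proof (cases "0 < u")
        case True
        have "u powr (- \<beta>) * u powr s = u powr (real (Suc k))"
          by (simp add: s_def powr_add[symmetric] add.commute)
        also have "\<dots> = u ^ Suc k" using True by (simp only: powr_realpow)
        finally have e: "u powr (- \<beta>) * f u * (u powr s / s) = 1 / s * (u ^ Suc k * f u)"
          by (metis (no_types, opaque_lifting) mult.assoc mult.commute times_divide_eq_left times_divide_eq_right mult_1)
        have "ennreal (u powr (- \<beta>) * f u) * (\<integral>\<^sup>+v. indicator {0<..u} v * ennreal (v powr (s - 1)) \<partial>lborel)
            = ennreal (u powr (- \<beta>) * f u) * ennreal (u powr s / s)"
          using True s by (simp add: nn_integral_powr)
        also have "\<dots> = ennreal (u powr (- \<beta>) * f u * (u powr s / s))"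
          using s f_nonneg by (intro ennreal_mult[symmetric]) auto
        also have "\<dots> = ennreal (1 / s) * ennreal (u ^ Suc k * f u)"
          unfolding e using s True f_nonneg by (intro ennreal_mult) auto
        finally show ?thesis .
      qed (simp add: f_eq_0)
    qed
    also have "\<dots> = ennreal (1 / s) * ennreal (moment (Suc k))"
      using nn_moment[of "Suc k"] by (simp add: nn_integral_cmult del: power_Suc)
    also have "\<dots> = ennreal (moment (Suc k) / s)"
      using s moment_nonneg by (simp add: ennreal_mult[symmetric])
    finally show ?thesis .
  qed
  \<comment> \<open>The Gamma integral is cut at \<open>x\<close>: below it \<open>exp (- v)\<close>
    is replaced by \<open>1\<close>, above it \<open>Q * exp (- v)\<close> by
    \<open>N v\<close>.\<close>
  have "ennreal Q * ennreal (Gamma s) = (\<integral>\<^sup>+t. ennreal Q * ennreal (indicator {0..} t * t powr (s - 1) / exp t) \<partial>lborel)"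
    using s by (simp add: Gamma_conv_nn_integral_real nn_integral_cmult)
  also have "\<dots> \<le> (\<integral>\<^sup>+v. ennreal Q * (indicator {0<..x} v * ennreal (v powr (s - 1)))
      + indicator {0<..} v * ennreal (v powr (s - 1)) * ennreal (N v) \<partial>lborel)"
  proof (rule nn_integral_mono)
    fix v
    consider "v \<le> 0" | "0 < v" "v \<le> x" | "x < v" by linarith
    then show "ennreal Q * ennreal (indicator {0..} v * v powr (s - 1) / exp v) \<le>
      ennreal Q * (indicator {0<..x} v * ennreal (v powr (s - 1)))
      + indicator {0<..} v * ennreal (v powr (s - 1)) * ennreal (N v)"
    proof cases
      case 1
      then show ?thesis using s by (cases "v = 0") auto
    next
      case 2
      have "v powr (s - 1) / exp v \<le> v powr (s - 1) / 1" using 2 by (intro divide_left_mono) auto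
      then have "ennreal Q * ennreal (v powr (s - 1) / exp v) \<le> ennreal Q * ennreal (v powr (s - 1))"
        by (intro mult_left_mono ennreal_leI) auto
      then show ?thesis using 2 by (simp add: add_increasing2)
    next
      case 3
      have "Q * (v powr (s - 1) / exp v) = v powr (s - 1) * (exp (x - v) * N x)"
        by (simp add: Q_def exp_diff)
      also have "\<dots> \<le> v powr (s - 1) * N v"
        using 3 x by (intro mult_left_mono exp_N_le) auto
      finally show ?thesis using 3 x Q N_nonneg by (simp add: ennreal_mult[symmetric] ennreal_leI)
    qed
  qed
  also have "\<dots> = ennreal Q * ennreal (x powr s / s) + ennreal (moment (Suc k) / s)"
    unfolding up[symmetric] using x s 
    by (subst nn_integral_add) (auto simp: nn_integral_cmult nn_integral_powr)
  also have "\<dots> = ennreal (Q * (x powr s / s) + moment (Suc k) / s)"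
    using s Q moment_nonneg by (simp add: ennreal_mult[symmetric] ennreal_plus[symmetric] del: ennreal_plus)
  finally have "ennreal (Q * Gamma s) \<le> ennreal (Q * (x powr s / s) + moment (Suc k) / s)"
    using ennreal_mult[OF Q less_imp_le[OF Gamma_real_pos[of s]]] s by simp
  then have "Q * Gamma s \<le> Q * (x powr s / s) + moment (Suc k) / s"
    by (subst (asm) ennreal_le_iff) (use s Q moment_nonneg in auto)
  then have "Q * (s * Gamma s) \<le> Q * x powr s + moment (Suc k)"
    using s by (simp add: field_simps)
  moreover have "s * Gamma s = Gamma (s + 1)"
    using s by (subst Gamma_plus1) (auto dest: nonpos_Ints_nonpos)
  moreover have "s + 1 = real k + \<beta> + 2" by (simp add: s_def)
  ultimately have "Q * Gamma (real k + \<beta> + 2) \<le> Q * x powr s + moment (Suc k)" by simp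
  then show ?thesis unfolding Q_def s_def right_diff_distrib by linarith
qed

text \<open>For fixed \<open>x\<close> the previous inequality is divided by Gamma and
  \<open>k\<close> tends to infinity. The bound that remains is the constant from the moments, which
  does not depend on \<open>x\<close>.\<close>

lemma N_bound: "\<exists>A. \<forall>x>0. exp x * N x \<le> A"
proof -
  obtain A where A: "\<And>n. nat \<lceil>4 * C\<rceil> \<le> n \<Longrightarrow> moment n \<le> A * Gamma (real n + \<beta> + 1)"
    using moment_bound by blast
  have "exp x * N x \<le> A" if x: "0 < x" for x
  proof (rule LIMSEQ_le_const2)
    show "(\<lambda>k. exp x * N x * (1 - x powr (real k + \<beta> + 1) / Gamma (real k + \<beta> + 2))) \<longlonglongrightarrow> exp x * N x"
      using tendsto_mult[OF tendsto_const tendsto_diff[OF tendsto_const powr_div_Gamma_tendsto_0[OF x \<beta>_pos]],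
          of "exp x * N x" 1] by simp
    have "exp x * N x * (1 - x powr (real k + \<beta> + 1) / Gamma (real k + \<beta> + 2)) \<le> A" if k: "nat \<lceil>4 * C\<rceil> \<le> k" for k
    proof -
      have G: "0 < Gamma (real k + \<beta> + 2)" using \<beta>_pos by (intro Gamma_real_pos) auto
      have "exp x * N x * (Gamma (real k + \<beta> + 2) - x powr (real k + \<beta> + 1)) \<le> A * Gamma (real k + \<beta> + 2)"
        using N_Gamma_le[OF x, of k] A[of "Suc k"] k by (simp add: add_ac)
      then show ?thesis using G by (simp add: field_simps)
    qed
    then show "\<exists>n. \<forall>k\<ge>n. exp x * N x * (1 - x powr (real k + \<beta> + 1) / Gamma (real k + \<beta> + 2)) \<le> A"
      by blast
  qed
  then show ?thesis by blast
qed

lemma N_pos_ex: "\<exists>x>0. 0 < N x"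
proof (rule ccontr)
  assume "\<not> ?thesis"
  then have "f x = 0" for x
    using f_le_N[of x] N_nonneg[of x] f_nonneg[of x] f_eq_0[of x]
    by (cases "0 < x") (auto simp: not_less dest!: spec[of _ x] antisym)
  then show False using f_mass by simp
qed

text \<open>The quadratic loss in \<open>K_lower\<close> is weakened to \<open>(u - x) / x\<close>.
  The mean excess of the weighted measure over \<open>x\<close> is the integral of \<open>N\<close>
  from \<open>x\<close> on, at most \<open>c * exp (- x)\<close>, so after multiplication by
  \<open>exp x\<close> the gap is \<open>C * c / x\<close> and vanishes at infinity.\<close>

lemma N_gap:
  assumes x: "0 < x" and c: "\<And>v. 0 < v \<Longrightarrow> exp v * N v \<le> c"
  shows "exp x * N x - C * c / x \<le> exp x * (x powr (- \<beta>) * f x)"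
proof -
  have c0: "0 \<le> c" using c[OF x] N_nonneg[of x] by (smt (verit) exp_gt_zero mult_nonneg_nonneg)
  have J: "(\<integral>\<^sup>+u. ennreal (u powr (- \<beta>) * f u) * ennreal (max 0 (u - x)) \<partial>lborel) \<le> ennreal (c * exp (- x))"
  proof -
    have "(\<integral>\<^sup>+u. ennreal (u powr (- \<beta>) * f u) * ennreal (max 0 (u - x)) \<partial>lborel) =
       (\<integral>\<^sup>+u. ennreal (u powr (- \<beta>) * f u) * (\<integral>\<^sup>+v. indicator {x<..u} v * 1 \<partial>lborel) \<partial>lborel)"
      by (intro nn_integral_cong arg_cong2[where f = "(*)"] refl)
         (auto simp: max_def not_le emeasure_lborel_Ioc split: if_splits)
    also have "\<dots> = (\<integral>\<^sup>+v. indicator {x<..} v * 1 * ennreal (N v) \<partial>lborel)"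
      using x by (intro layer_cake[symmetric]) auto
    also have "\<dots> \<le> (\<integral>\<^sup>+v. ennreal (indicator {x..} v *\<^sub>R (c * exp (- 1 * v))) \<partial>lborel)"
    proof (rule nn_integral_mono)
      fix v
      have "N v \<le> c * exp (- v)" if "x < v" using c[of v] that x by (simp add: exp_minus field_simps)
      then show "indicator {x<..} v * 1 * ennreal (N v) \<le> ennreal (indicator {x..} v *\<^sub>R (c * exp (- 1 * v)))"
        by (auto simp: indicator_def ennreal_leI)
    qed
    also have "\<dots> = ennreal (LINT v:{x..}|lborel. c * exp (- 1 * v))"
      unfolding set_lebesgue_integral_def using c0 integral_exp_tail(1)[of 1 x]
      by (intro nn_integral_eq_integral)
         (auto simp: set_integrable_def mult.left_commute[of _ c] intro!: integrable_mult_right)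
    also have "\<dots> = ennreal (c * exp (- x))"
      using integral_exp_tail(2)[of 1 x] by simp
    finally show ?thesis .
  qed
  have "ennreal (N x) = (\<integral>\<^sup>+u. indicator {x..} u * ennreal (u powr (- \<beta>) * f u) \<partial>lborel)"
    using nn_N[OF x] .
  also have "\<dots> \<le> (\<integral>\<^sup>+u. ennreal (x powr (- \<beta>)) * ennreal (K (u / x) * f u) +
      ennreal (C / x) * (ennreal (u powr (- \<beta>) * f u) * ennreal (max 0 (u - x))) \<partial>lborel)"
  proof (rule nn_integral_mono)
    fix u
    show "indicator {x..} u * ennreal (u powr (- \<beta>) * f u) \<le> ennreal (x powr (- \<beta>)) * ennreal (K (u / x) * f u) +
      ennreal (C / x) * (ennreal (u powr (- \<beta>) * f u) * ennreal (max 0 (u - x)))"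
    proof (cases "x \<le> u")
      case True
      have "(1 - x / u)\<^sup>2 \<le> (1 - x / u) * 1"
        unfolding power2_eq_square using True x by (intro mult_left_mono) auto
      also have "\<dots> = (u - x) / u" using True x by (simp add: field_simps)
      also have "\<dots> \<le> (u - x) / x" using True x by (intro divide_left_mono) auto
      finally have "C * (1 - x / u)\<^sup>2 \<le> C * ((u - x) / x)" using C_nonneg by (intro mult_left_mono)
      then have "u powr (- \<beta>) * (1 - C * ((u - x) / x)) \<le> u powr (- \<beta>) * (1 - C * (1 - x / u)\<^sup>2)"
        by (intro mult_left_mono) auto
      also have "\<dots> = x powr (- \<beta>) * ((u / x) powr (- \<beta>) * (1 - C * (1 - 1 / (u / x))\<^sup>2))"
        using True x by (simp add: powr_divide)
      also have "\<dots> \<le> x powr (- \<beta>) * K (u / x)"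
        using True x by (intro mult_left_mono K_lower) auto
      finally have "u powr (- \<beta>) * (1 - C * ((u - x) / x)) * f u \<le> x powr (- \<beta>) * K (u / x) * f u"
        by (intro mult_right_mono f_nonneg)
      moreover have "u powr (- \<beta>) * (1 - C * ((u - x) / x)) * f u =
          u powr (- \<beta>) * f u - C / x * (u powr (- \<beta>) * f u * (u - x))"
        using x by (simp add: field_simps)
      ultimately have "u powr (- \<beta>) * f u \<le> x powr (- \<beta>) * (K (u / x) * f u) + C / x * (u powr (- \<beta>) * f u * (u - x))"
        by (simp add: mult.assoc)
      then have "ennreal (u powr (- \<beta>) * f u) \<le>
          ennreal (x powr (- \<beta>) * (K (u / x) * f u) + C / x * (u powr (- \<beta>) * f u * (u - x)))"
        by (rule ennreal_leI)
      also have "\<dots> = ennreal (x powr (- \<beta>)) * ennreal (K (u / x) * f u) +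
          ennreal (C / x) * (ennreal (u powr (- \<beta>) * f u) * ennreal (max 0 (u - x)))"
        using True x C_nonneg f_nonneg K_nonneg
        by (simp add: ennreal_mult[symmetric] ennreal_plus[symmetric] del: ennreal_plus)
      finally show ?thesis using True by simp
    qed simp
  qed
  also have "\<dots> = ennreal (x powr (- \<beta>)) * ennreal (f x) + ennreal (C / x) *
      (\<integral>\<^sup>+u. ennreal (u powr (- \<beta>) * f u) * ennreal (max 0 (u - x)) \<partial>lborel)"
    by (subst nn_integral_add) (auto simp: nn_integral_cmult f_eq_nn)
  also have "\<dots> \<le> ennreal (x powr (- \<beta>)) * ennreal (f x) + ennreal (C / x) * ennreal (c * exp (- x))"
    by (intro add_left_mono mult_left_mono J) auto
  also have "\<dots> = ennreal (x powr (- \<beta>) * f x + C / x * (c * exp (- x)))"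
    using x C_nonneg c0 f_nonneg
    by (simp add: ennreal_mult[symmetric] ennreal_plus[symmetric] del: ennreal_plus)
  finally have "N x \<le> x powr (- \<beta>) * f x + C / x * (c * exp (- x))"
    by (subst (asm) ennreal_le_iff) (use x C_nonneg c0 f_nonneg in auto)
  then have "exp x * N x \<le> exp x * (x powr (- \<beta>) * f x + C / x * (c * exp (- x)))"
    by (intro mult_left_mono) auto
  then show ?thesis by (simp add: algebra_simps exp_minus)
qed

text \<open>\<open>exp x * N x\<close> is increasing and bounded, and its supremum is the limit
  \<open>c\<close>. The same \<open>c\<close> serves in the global upper bound, so \<open>f\<close>
  lies everywhere below the profile it approaches; the convergence of the iterates relies on
  this.\<close>

lemma f_asymptotics:
  "\<exists>c>0. (\<forall>x>0. f x \<le> c * (x powr \<beta> * exp (- x))) \<and>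
     ((\<lambda>x. exp x * (x powr (- \<beta>) * f x)) \<longlongrightarrow> c) at_top"
proof -
  obtain A where A: "\<And>x. 0 < x \<Longrightarrow> exp x * N x \<le> A" using N_bound by blast
  define c where "c = (SUP x\<in>{0<..}. exp x * N x)"
  have bdd: "bdd_above ((\<lambda>x. exp x * N x) ` {0<..})" using A by (auto intro!: bdd_aboveI2)
  have le: "exp x * N x \<le> c" if "0 < x" for x
    unfolding c_def using that by (intro cSUP_upper bdd) auto
  have mono: "exp x * N x \<le> exp y * N y" if "0 < x" "x \<le> y" for x y
    using exp_N_le[OF that] by (simp add: exp_diff field_simps)
  obtain x0 where "0 < x0" "0 < N x0" using N_pos_ex by blast
  then have "0 < exp x0 * N x0" by simp
  then have c: "0 < c" using le[OF \<open>0 < x0\<close>] by linarith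
  have Q: "((\<lambda>x. exp x * N x) \<longlongrightarrow> c) at_top"
  proof (rule increasing_tendsto)
    show "\<forall>\<^sub>F x in at_top. exp x * N x \<le> c"
      using eventually_gt_at_top[of 0] by eventually_elim (rule le)
    fix l assume "l < c"
    then obtain x where x: "0 < x" "l < exp x * N x"
      unfolding c_def using less_cSUP_iff[OF _ bdd, of l] by auto
    show "\<forall>\<^sub>F y in at_top. l < exp y * N y"
      using eventually_ge_at_top[of x] by eventually_elim (use x mono in force)
  qed
  have up: "exp x * (x powr (- \<beta>) * f x) \<le> exp x * N x" if "0 < x" for x
    using f_le_N[OF that] that by (simp add: powr_minus field_simps)
  have lim: "((\<lambda>x. exp x * (x powr (- \<beta>) * f x)) \<longlongrightarrow> c) at_top"
  proof (rule tendsto_sandwich)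
    show "\<forall>\<^sub>F x in at_top. exp x * N x - C * c / x \<le> exp x * (x powr (- \<beta>) * f x)"
      using eventually_gt_at_top[of 0] by eventually_elim (rule N_gap[OF _ le])
    show "\<forall>\<^sub>F x in at_top. exp x * (x powr (- \<beta>) * f x) \<le> exp x * N x"
      using eventually_gt_at_top[of 0] by eventually_elim (rule up)
    have "((\<lambda>x. C * c / x) \<longlongrightarrow> 0) at_top"
      by (intro tendsto_divide_0[OF tendsto_const] filterlim_at_top_imp_at_infinity filterlim_ident)
    from tendsto_diff[OF Q this] show "((\<lambda>x. exp x * N x - C * c / x) \<longlongrightarrow> c) at_top" by simp
  qed (rule Q)
  have "f x \<le> c * (x powr \<beta> * exp (- x))" if "0 < x" for x
    using order_trans[OF up[OF that] le[OF that]] that by (simp add: powr_minus exp_minus field_simps)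
  with c lim show ?thesis by blast
qed

section \<open>Positivity and continuity of the fixed point\<close>

lemma f_pos: assumes "0 < x" shows "0 < f x"
proof -
  obtain c where c: "0 < c" "((\<lambda>x. exp x * (x powr (- \<beta>) * f x)) \<longlongrightarrow> c) at_top"
    using f_asymptotics by blast
  have "\<forall>\<^sub>F x in at_top. 0 < exp x * (x powr (- \<beta>) * f x)"
    using order_tendstoD(1)[OF c(2,1)] .
  then obtain M0 where M0: "\<And>x. M0 \<le> x \<Longrightarrow> 0 < exp x * (x powr (- \<beta>) * f x)"
    by (auto simp: eventually_at_top_linorder)
  define M where "M = max M0 1"
  have M: "0 < M" "\<And>x. M < x \<Longrightarrow> 0 < f x"
    using M0 by (auto simp: M_def zero_less_mult_iff)
  \<comment> \<open>Positivity spreads downwards: if \<open>f\<close> is positive beyond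
    \<open>y\<close> and \<open>x > y / b\<close>, the window from \<open>x\<close> to
    \<open>b * x\<close> on which the kernel is positive reaches beyond \<open>y\<close>.\<close>
  have "\<forall>x. M / b ^ n < x \<longrightarrow> 0 < f x" for n
  proof (induction n)
    case (Suc n)
    define y where "y = M / b ^ n"
    have y: "0 < y" "\<And>x. y < x \<Longrightarrow> 0 < f x" using Suc M b_gt_1 by (auto simp: y_def)
    have "0 < f x" if x: "y / b < x" for x
    proof -
      have x0: "0 < x" using x y(1) b_gt_1 by (meson divide_pos_pos less_trans zero_less_one)
      have "0 < (LINT u|lborel. K (u / x) * f u)"
      proof (rule integral_pos_interval[OF integrable_K_mult[OF f_int]])
        show "0 \<le> K (u / x) * f u" for u using K_nonneg f_nonneg by simp
        have "y < b * x" using x b_gt_1 by (simp add: field_simps)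
        then show "max x y < b * x" using x0 b_gt_1 by simp
        show "0 < K (u / x) * f u" if "max x y < u" "u < b * x" for u
          using that x0 y by (intro mult_pos_pos K_pos) (auto simp: field_simps)
      qed
      then show ?thesis using f_eq[OF x0] by simp
    qed
    then show ?case by (simp add: y_def mult.commute)
  qed (use M in simp)
  moreover obtain n where "M / x < b ^ n" using real_arch_pow[OF b_gt_1] by blast
  then have "M / b ^ n < x" using assms b_gt_1 by (simp add: field_simps)
  ultimately show ?thesis by blast
qed

text \<open>Dominated convergence. The jump of \<open>K\<close> at \<open>1\<close> is met only at
  \<open>u = x\<close>, a null set.\<close>

lemma f_isCont: assumes "0 < x" shows "isCont f x"
  unfolding continuous_at_sequentially
proof (intro allI impI)
  fix X assume X: "X \<longlonglongrightarrow> x"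
  have ev: "\<forall>\<^sub>F n in sequentially. 0 < X n" using order_tendstoD(1)[OF X assms] .
  have "(\<lambda>n. LINT u|lborel. K (u / X n) * f u) \<longlonglongrightarrow> (LINT u|lborel. K (u / x) * f u)"
  proof (rule integral_dominated_convergence[where w = f])
    show "AE u in lborel. (\<lambda>n. K (u / X n) * f u) \<longlonglongrightarrow> K (u / x) * f u"
      using AE_lborel_singleton[of x]
    proof eventually_elim
      case (elim u)
      then have "isCont K (u / x)" using assms by (intro K_isCont) simp
      moreover have "(\<lambda>n. u / X n) \<longlonglongrightarrow> u / x" using X assms by (intro tendsto_intros) auto
      ultimately show ?case by (intro tendsto_mult tendsto_const) (rule isCont_tendsto_compose)
    qed
    show "AE u in lborel. norm (K (u / X n) * f u) \<le> f u" for n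
      using K_nonneg K_le_1 f_nonneg by (intro AE_I2) (auto simp: abs_mult intro!: mult_left_le_one_le)
  qed (use f_int in auto)
  then have "(\<lambda>n. LINT u|lborel. K (u / X n) * f u) \<longlonglongrightarrow> f x" using f_eq[OF assms] by simp
  moreover have "\<forall>\<^sub>F n in sequentially. (LINT u|lborel. K (u / X n) * f u) = (f \<circ> X) n"
    using ev by eventually_elim (simp add: f_eq)
  ultimately show "(f \<circ> X) \<longlonglongrightarrow> f x" by (rule Lim_transform_eventually)
qed

end

section \<open>Log-concavity of the fixed point\<close>

lemma mult_log_concave_limit:
  assumes lim: "\<And>x. 0 < x \<Longrightarrow> (\<lambda>n. \<phi> n x) \<longlonglongrightarrow> \<psi> x" and lc: "\<And>n::nat. mult_log_concave (\<phi> n)"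
  shows "mult_log_concave \<psi>"
  unfolding mult_log_concave_def
proof (intro allI impI)
  fix x x' \<rho> :: real assume *: "0 < x" "x \<le> x'" "1 \<le> \<rho>"
  show "\<psi> x * \<psi> (\<rho> * x') \<le> \<psi> (\<rho> * x) * \<psi> x'"
  proof (rule LIMSEQ_le)
    show "(\<lambda>n. \<phi> n x * \<phi> n (\<rho> * x')) \<longlonglongrightarrow> \<psi> x * \<psi> (\<rho> * x')"
      "(\<lambda>n. \<phi> n (\<rho> * x) * \<phi> n x') \<longlonglongrightarrow> \<psi> (\<rho> * x) * \<psi> x'"
      using * by (intro tendsto_mult lim; simp)+
    show "\<exists>N. \<forall>n\<ge>N. \<phi> n x * \<phi> n (\<rho> * x') \<le> \<phi> n (\<rho> * x) * \<phi> n x'"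
      using mult_log_concaveD[OF lc *] by blast
  qed
qed

context log_concave_kernel
begin

lemma T_le_exp:
  assumes [measurable]: "\<phi> \<in> borel_measurable borel" and zero: "\<And>u. u \<le> 0 \<Longrightarrow> \<phi> u = 0"
    and \<theta>: "0 < \<theta>" and bound: "\<And>u. 0 < u \<Longrightarrow> \<bar>\<phi> u\<bar> \<le> A * exp (- \<theta> * u)" and x: "0 < x"
  shows "\<bar>T \<phi> x\<bar> \<le> A / \<theta> * exp (- \<theta> * x)"
proof -
  have int: "integrable lborel \<phi>" by (rule integrable_exp_bound[OF assms(1,2) \<theta> bound])
  have int2: "integrable lborel (\<lambda>u. A * (indicator {x..} u *\<^sub>R exp (- \<theta> * u)))"
    using integral_exp_tail(1)[OF \<theta>, of x] unfolding set_integrable_def by (rule integrable_mult_right)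
  have A: "0 \<le> A" using bound[of 1] by (smt (verit) exp_gt_zero zero_le_mult_iff)
  have "\<bar>T \<phi> x\<bar> \<le> (LINT u|lborel. \<bar>K (u / x) * \<phi> u\<bar>)"
    using x integral_abs_bound[of lborel "\<lambda>u. K (u / x) * \<phi> u"] by (simp add: T_def)
  also have "\<dots> \<le> (LINT u|lborel. A * (indicator {x..} u *\<^sub>R exp (- \<theta> * u)))"
  proof (intro integral_mono integrable_abs integrable_K_mult int int2)
    fix u
    show "\<bar>K (u / x) * \<phi> u\<bar> \<le> A * (indicator {x..} u *\<^sub>R exp (- \<theta> * u))"
    proof (cases "x \<le> u")
      case True
      then have "\<bar>K (u / x) * \<phi> u\<bar> \<le> \<bar>\<phi> u\<bar>"
        using K_nonneg K_le_1 by (auto simp: abs_mult intro!: mult_left_le_one_le)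
      also have "\<dots> \<le> A * exp (- \<theta> * u)" using True x by (intro bound) simp
      finally show ?thesis using True by simp
    next
      case False
      then show ?thesis using x K_eq_0[of "u / x"] by simp
    qed
  qed
  also have "\<dots> = A * (LINT u:{x..}|lborel. exp (- \<theta> * u))"
    by (simp add: set_lebesgue_integral_def)
  finally show ?thesis using integral_exp_tail(2)[OF \<theta>, of x] by simp
qed

text \<open>The remainder in \<open>T_ratio\<close> is nonnegative, because on
  \<open>[x, x')\<close> log-concavity carries the sign of the difference at \<open>x'\<close> to
  the left.\<close>

lemma T_mult_log_concave:
  assumes int: "integrable lborel \<phi>" and pos: "\<And>u. 0 < u \<Longrightarrow> 0 < \<phi> u" and zero: "\<And>u. u \<le> 0 \<Longrightarrow> \<phi> u = 0"
    and lc: "mult_log_concave \<phi>"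
  shows "mult_log_concave (T \<phi>)"
  unfolding mult_log_concave_def
proof (intro allI impI)
  fix x x' \<rho> :: real assume x: "0 < x" "x \<le> x'" and \<rho>: "1 \<le> \<rho>"
  define R where "R = T \<phi> (\<rho> * x') / (\<rho> * T \<phi> x')"
  note ratio = T_ratio[OF int pos zero lc x \<rho>, folded R_def]
  have nn: "0 \<le> \<phi> u" for u using pos[of u] zero[of u] by fastforce
  have "0 < T \<phi> x'" using x integral_K_pos[OF int, of x' "x' + 1"] nn pos by (auto simp: T_def)
  have "0 \<le> (LINT u:{x..<x'}|lborel. K (u / x) * (\<phi> (\<rho> * u) - R * \<phi> u))"
    unfolding set_lebesgue_integral_def
  proof (rule Bochner_Integration.integral_nonneg)
    fix u
    show "0 \<le> indicator {x..<x'} u *\<^sub>R (K (u / x) * (\<phi> (\<rho> * u) - R * \<phi> u))"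
    proof (cases "x \<le> u \<and> u < x'")
      case True
      have "R * \<phi> u * \<phi> x' = R * \<phi> x' * \<phi> u" by simp
      also have "\<dots> \<le> \<phi> (\<rho> * x') * \<phi> u" by (intro mult_right_mono ratio(2) nn)
      also have "\<dots> \<le> \<phi> (\<rho> * u) * \<phi> x'"
        using mult_log_concaveD[OF lc, of u x' \<rho>] True x \<rho> by (simp add: mult.commute)
      finally have "R * \<phi> u \<le> \<phi> (\<rho> * u)" using pos[of x'] x by simp
      then show ?thesis using K_nonneg by simp
    qed (auto simp: indicator_def)
  qed
  then have "0 \<le> T \<phi> (\<rho> * x) / \<rho> - R * T \<phi> x" using ratio(1) by linarith
  then show "T \<phi> x * T \<phi> (\<rho> * x') \<le> T \<phi> (\<rho> * x) * T \<phi> x'"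
    using \<open>0 < T \<phi> x'\<close> \<rho> by (simp add: R_def field_simps)
qed

lemma T_borel: assumes [measurable]: "\<phi> \<in> borel_measurable borel" shows "T \<phi> \<in> borel_measurable borel"
  unfolding T_def[abs_def] by measurable

text \<open>A class closed under \<open>T\<close> that contains the limiting profile. The
  exponential bound keeps all iterates integrable; its constant may grow from one iterate to the
  next, since only the rate has to be preserved.\<close>

definition regular :: "(real \<Rightarrow> real) \<Rightarrow> bool" where
  "regular \<phi> \<longleftrightarrow> \<phi> \<in> borel_measurable borel \<and> (\<forall>u\<le>0. \<phi> u = 0) \<and> (\<forall>u>0. 0 < \<phi> u) \<and>
     (\<exists>A. \<forall>u>0. \<phi> u \<le> A * exp (- (1 / 2) * u)) \<and> mult_log_concave \<phi>"

lemma regular_integrable: assumes "regular \<phi>" shows "integrable lborel \<phi>"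
proof -
  obtain A where A: "\<And>u. 0 < u \<Longrightarrow> \<phi> u \<le> A * exp (- (1 / 2) * u)"
    using assms unfolding regular_def by blast
  show ?thesis
    by (rule integrable_exp_bound[of _ "1 / 2" A]) (use assms A in \<open>auto simp: regular_def less_imp_le\<close>)
qed

lemma regular_T: assumes "regular \<phi>" shows "regular (T \<phi>)"
proof -
  obtain A where A: "\<And>u. 0 < u \<Longrightarrow> \<phi> u \<le> A * exp (- (1 / 2) * u)"
    using assms unfolding regular_def by blast
  have \<phi>: "\<phi> \<in> borel_measurable borel" "\<And>u. u \<le> 0 \<Longrightarrow> \<phi> u = 0" "\<And>u. 0 < u \<Longrightarrow> 0 < \<phi> u" "mult_log_concave \<phi>"
    using assms unfolding regular_def by auto
  note int = regular_integrable[OF assms]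
  have nn: "0 \<le> \<phi> u" for u using \<phi>(2,3)[of u] by fastforce
  have "0 < T \<phi> x" if "0 < x" for x
    using that integral_K_pos[OF int, of x "x + 1"] nn \<phi>(3) by (auto simp: T_def)
  moreover have "T \<phi> x \<le> A / (1 / 2) * exp (- (1 / 2) * x)" if "0 < x" for x
    using T_le_exp[OF \<phi>(1,2), of "1 / 2" A x] A \<phi>(3) that by (force simp: less_imp_le abs_of_pos)
  moreover have "T \<phi> u = 0" if "u \<le> 0" for u using that by (simp add: T_def)
  ultimately show ?thesis
    using T_borel[OF \<phi>(1)] T_mult_log_concave[OF int \<phi>(3,2,4)] unfolding regular_def by blast
qed

lemma regular_T_iterate: "regular \<phi> \<Longrightarrow> regular ((T ^^ n) \<phi>)"
  by (induction n) (auto intro: regular_T)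

lemma regular_gamma_profile:
  assumes "0 < c"
  shows "regular (\<lambda>x. if 0 < x then c * (x powr \<beta> * exp (- x)) else 0)" (is "regular ?g")
  unfolding regular_def
proof (intro conjI)
  show "?g \<in> borel_measurable borel" by measurable
  have "?g u \<le> (c * (2 * \<beta>) powr \<beta>) * exp (- (1 / 2) * u)" if u: "0 < u" for u
  proof -
    have "?g u \<le> c * ((2 * \<beta>) powr \<beta> * exp (u / 2) * exp (- u))"
      using u assms powr_le_exp_half[OF u \<beta>_pos] by (auto intro!: mult_left_mono mult_right_mono)
    also have "\<dots> = (c * (2 * \<beta>) powr \<beta>) * exp (u / 2 + - u)" by (simp only: exp_add mult.assoc)
    finally show ?thesis by simp
  qed
  then show "\<exists>A. \<forall>u>0. ?g u \<le> A * exp (- (1 / 2) * u)" by blast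
  show "mult_log_concave ?g"
    unfolding mult_log_concave_def
  proof (intro allI impI)
    fix x x' \<rho> :: real assume x: "0 < x" "x \<le> x'" "1 \<le> \<rho>"
    \<comment> \<open>The power factors agree on both sides of the inequality; only the exponentials
      differ, and they compare by \<open>(\<rho> - 1) * (x' - x) \<ge> 0\<close>.\<close>
    have "(\<rho> - 1) * x \<le> (\<rho> - 1) * x'" using x by (intro mult_left_mono) auto
    then have "exp (- x + - (\<rho> * x')) \<le> exp (- (\<rho> * x) + - x')" by (simp add: algebra_simps)
    then have "c * c * (x powr \<beta> * (\<rho> * x') powr \<beta>) * exp (- x + - (\<rho> * x')) \<le>
        c * c * (x powr \<beta> * (\<rho> * x') powr \<beta>) * exp (- (\<rho> * x) + - x')"
      using assms by (intro mult_left_mono) auto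
    then have "c * c * (x powr \<beta> * (\<rho> * x') powr \<beta>) * (exp (- x) * exp (- (\<rho> * x'))) \<le>
        c * c * (x powr \<beta> * (\<rho> * x') powr \<beta>) * (exp (- (\<rho> * x)) * exp (- x'))"
      by (simp only: exp_add)
    then show "?g x * ?g (\<rho> * x') \<le> ?g (\<rho> * x) * ?g x'"
      using x by (simp add: powr_mult mult_ac)
  qed
qed (use assms in auto)

end

context kernel_density
begin

text \<open>The part \<open>\<epsilon> * f\<close> of the error reproduces itself because
  \<open>f\<close> is a fixed point. The part \<open>D * exp (- 2 * u)\<close> is halved, as its
  tail integral is \<open>exp (- 2 * x) / 2\<close>; any rate above \<open>1\<close> would contract
  likewise. Two parts are needed since a relative error near infinity decays only like
  \<open>f\<close>.\<close>

lemma f_T_contraction: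
  assumes \<phi>: "regular \<phi>" and le: "\<And>u. 0 < u \<Longrightarrow> \<bar>f u - \<phi> u\<bar> \<le> \<epsilon> * f u + D * exp (- 2 * u)"
    and D: "0 \<le> D" and x: "0 < x"
  shows "\<bar>f x - T \<phi> x\<bar> \<le> \<epsilon> * f x + D / 2 * exp (- 2 * x)"
proof -
  note int\<phi> = regular_integrable[OF \<phi>]
  have i: "integrable lborel (\<lambda>u. indicator {x..} u *\<^sub>R exp (- 2 * u))"
    using integral_exp_tail(1)[of 2 x] by (simp add: set_integrable_def)
  have iD: "integrable lborel (\<lambda>u. \<epsilon> * (K (u / x) * f u) + D * (indicator {x..} u *\<^sub>R exp (- 2 * u)))"
    by (intro Bochner_Integration.integrable_add integrable_mult_right integrable_K_mult f_int i)
  have "f x - T \<phi> x = (LINT u|lborel. K (u / x) * (f u - \<phi> u))"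
    using x f_eq[OF x] Bochner_Integration.integral_diff[OF integrable_K_mult[OF f_int] integrable_K_mult[OF int\<phi>], of x x]
    by (simp add: T_def right_diff_distrib)
  also have "\<bar>\<dots>\<bar> \<le> (LINT u|lborel. \<bar>K (u / x) * (f u - \<phi> u)\<bar>)"
    by (rule integral_abs_bound)
  also have "\<dots> \<le> (LINT u|lborel. \<epsilon> * (K (u / x) * f u) + D * (indicator {x..} u *\<^sub>R exp (- 2 * u)))"
  proof (intro integral_mono iD integrable_abs integrable_K_mult Bochner_Integration.integrable_diff f_int int\<phi>)
    fix u
    show "\<bar>K (u / x) * (f u - \<phi> u)\<bar> \<le> \<epsilon> * (K (u / x) * f u) + D * (indicator {x..} u *\<^sub>R exp (- 2 * u))"
    proof (cases "x \<le> u")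
      case True
      have "K (u / x) * (D * exp (- 2 * u)) \<le> D * exp (- 2 * u)"
        using K_nonneg K_le_1 D by (intro mult_left_le_one_le) auto
      moreover have "\<bar>K (u / x) * (f u - \<phi> u)\<bar> \<le> K (u / x) * (\<epsilon> * f u + D * exp (- 2 * u))"
        using le[of u] True x K_nonneg by (simp add: abs_mult mult_left_mono)
      ultimately show ?thesis using True by (simp add: algebra_simps)
    next
      case False
      then show ?thesis using x K_eq_0[of "u / x"] by simp
    qed
  qed
  also have "\<dots> = \<epsilon> * f x + D * (LINT u:{x..}|lborel. exp (- 2 * u))"
    using f_eq[OF x] integrable_K_mult[OF f_int, of x] i by (simp add: set_lebesgue_integral_def)
  also have "(LINT u:{x..}|lborel. exp (- 2 * u)) = exp (- 2 * x) / 2"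
    by (rule integral_exp_tail(2)) simp
  finally show ?thesis by simp
qed

text \<open>The profile of the asymptotics at infinity is log-concave, and since \<open>T\<close> pushes mass to infinity
  its iterates recover \<open>f\<close>.\<close>
lemma f_mult_log_concave: "mult_log_concave f"
proof -
  obtain c where c: "0 < c" and le: "\<And>x. 0 < x \<Longrightarrow> f x \<le> c * (x powr \<beta> * exp (- x))"
    and lim: "((\<lambda>x. exp x * (x powr (- \<beta>) * f x)) \<longlongrightarrow> c) at_top"
    using f_asymptotics by blast
  define g where "g x = (if 0 < x then c * (x powr \<beta> * exp (- x)) else 0)" for x
  have g: "regular g" unfolding g_def by (rule regular_gamma_profile[OF c])
  have "(\<lambda>n. (T ^^ n) g x) \<longlonglongrightarrow> f x" if x: "0 < x" for x
  proof (rule LIMSEQ_I)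
    fix r :: real assume r: "0 < r"
    define \<epsilon> where "\<epsilon> = r / (2 * (f x + 1))"
    have \<epsilon>: "0 < \<epsilon>" "\<epsilon> * f x \<le> r / 2" using r f_nonneg[of x] by (auto simp: \<epsilon>_def field_simps)
    have "((\<lambda>x. c / (exp x * (x powr (- \<beta>) * f x))) \<longlongrightarrow> c / c) at_top"
      using c by (intro tendsto_intros lim) auto
    then have "\<forall>\<^sub>F x in at_top. dist (c / (exp x * (x powr (- \<beta>) * f x))) 1 < \<epsilon>"
      using c \<epsilon> by (simp add: tendsto_iff)
    then obtain M0 where M0: "\<And>x. M0 \<le> x \<Longrightarrow> \<bar>c / (exp x * (x powr (- \<beta>) * f x)) - 1\<bar> < \<epsilon>"
      by (auto simp: eventually_at_top_linorder dist_real_def)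
    define M where "M = max M0 1"
    \<comment> \<open>Pays for the error on \<open>(0, M)\<close>: there
      \<open>0 \<le> f u \<le> g u \<le> c * M powr \<beta>\<close>, while
      \<open>exp (2 * M - 2 * u)\<close> is at least \<open>1\<close>. Beyond \<open>M\<close> the
      relative error is below \<open>\<epsilon>\<close>.\<close>
    define D where "D = c * M powr \<beta> * exp (2 * M)"
    have D: "0 \<le> D" using c by (simp add: D_def)
    have init: "\<bar>f u - g u\<bar> \<le> \<epsilon> * f u + D * exp (- 2 * u)" if u: "0 < u" for u
    proof (cases "M \<le> u")
      case True
      have "f u - g u = - f u * (c / (exp u * (u powr (- \<beta>) * f u)) - 1)"
        using u f_pos[OF u] by (simp add: g_def exp_minus powr_minus field_simps)
      then have "\<bar>f u - g u\<bar> = f u * \<bar>c / (exp u * (u powr (- \<beta>) * f u)) - 1\<bar>"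
        using f_pos[OF u] by (simp add: abs_mult)
      also have "\<dots> \<le> f u * \<epsilon>" using M0[of u] True f_pos[OF u] by (intro mult_left_mono) (auto simp: M_def)
      finally show ?thesis using D by (simp add: mult.commute add_increasing2)
    next
      case False
      have "u powr \<beta> * exp (- u) \<le> M powr \<beta> * 1"
        using u False \<beta>_pos by (intro mult_mono powr_mono2) auto
      then have gM: "g u \<le> c * (M powr \<beta> * 1)" using u c by (simp add: g_def)
      have "\<bar>f u - g u\<bar> \<le> g u" using le[OF u] f_nonneg[of u] u by (simp add: g_def)
      also have "g u \<le> c * (M powr \<beta> * 1)" by (rule gM)
      also have "\<dots> \<le> c * (M powr \<beta> * exp (2 * M + - 2 * u))"
        using c False by (intro mult_left_mono) auto
      also have "\<dots> = D * exp (- 2 * u)" by (simp only: D_def exp_add mult.assoc)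
      finally show ?thesis using \<epsilon> f_nonneg[of u] by (simp add: add_increasing)
    qed
    \<comment> \<open>Along the iteration \<open>\<epsilon>\<close> stays fixed and \<open>D\<close>
      is halved at each step.\<close>
    have "\<bar>f u - (T ^^ n) g u\<bar> \<le> \<epsilon> * f u + D / 2 ^ n * exp (- 2 * u)" if "0 < u" for u n
      using that
    proof (induction n arbitrary: u)
      case 0
      then show ?case using init by simp
    next
      case (Suc n)
      from f_T_contraction[OF regular_T_iterate[OF g] Suc.IH _ Suc.prems] D show ?case
        by (simp add: mult.commute)
    qed
    note bound = this[OF x]
    have "(\<lambda>n. D * exp (- 2 * x) * (1 / 2) ^ n) \<longlonglongrightarrow> 0"
      by (intro tendsto_mult_right_zero LIMSEQ_realpow_zero) auto
    moreover have "D / 2 ^ n * exp (- 2 * x) = D * exp (- 2 * x) * (1 / 2) ^ n" for n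
      by (simp add: power_one_over)
    ultimately have "(\<lambda>n. D / 2 ^ n * exp (- 2 * x)) \<longlonglongrightarrow> 0" by simp
    then have "\<forall>\<^sub>F n in sequentially. D / 2 ^ n * exp (- 2 * x) < r / 2"
      using r by (intro order_tendstoD(2)) auto
    then have "\<forall>\<^sub>F n in sequentially. norm ((T ^^ n) g x - f x) < r"
    proof eventually_elim
      case (elim n)
      then show ?case using bound[of n] \<epsilon>(2) unfolding real_norm_def by linarith
    qed
    then show "\<exists>no. \<forall>n\<ge>no. norm ((T ^^ n) g x - f x) < r"
      by (simp add: eventually_sequentially)
  qed
  moreover have "mult_log_concave ((T ^^ n) g)" for n
    using regular_T_iterate[OF g, of n] unfolding regular_def by blast
  ultimately show ?thesis by (rule mult_log_concave_limit)
qed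

text \<open>For the fixed point \<open>T f = f\<close> the constant \<open>R\<close> is the ratio
  \<open>f (\<rho> * x') / f x'\<close> divided by \<open>\<rho> > 1\<close>. Weak log-concavity
  already puts \<open>f (\<rho> * u) / f u\<close> above the undivided ratio for
  \<open>u < x'\<close>, so the remainder integral is strictly positive.\<close>

lemma f_strict:
  assumes x: "0 < x" "x < x'" and \<rho>: "1 < \<rho>"
  shows "f x * f (\<rho> * x') < f (\<rho> * x) * f x'"
proof -
  define R where "R = f (\<rho> * x') / (\<rho> * f x')"
  have x': "0 < x'" "x \<le> x'" "1 \<le> \<rho>" using x \<rho> by auto
  have R0: "0 < R" using x' \<rho> f_pos by (simp add: R_def)
  have *: "(LINT u:{x..<x'}|lborel. K (u / x) * (f (\<rho> * u) - R * f u)) \<le> f (\<rho> * x) / \<rho> - R * f x"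
    using T_ratio(1)[OF f_int f_pos f_eq_0 f_mult_log_concave x(1) x'(2,3), folded f_eq_T, folded R_def] .
  have w: "0 < f (\<rho> * u) - R * f u" if u: "x \<le> u" "u < x'" for u
  proof -
    have "R * f u * f x' < \<rho> * R * f u * f x'"
      using R0 f_pos[of u] f_pos[of x'] x x' u \<rho> by simp
    also have "\<dots> = f u * f (\<rho> * x')" using f_pos[OF x'(1)] \<rho> by (simp add: R_def field_simps)
    also have "\<dots> \<le> f (\<rho> * u) * f x'"
      using mult_log_concaveD[OF f_mult_log_concave, of u x' \<rho>] x u \<rho> by simp
    finally show ?thesis using f_pos[OF x'(1)] by simp
  qed
  have "0 < (LINT u:{x..<x'}|lborel. K (u / x) * (f (\<rho> * u) - R * f u))"
    unfolding set_lebesgue_integral_def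
  proof (rule integral_pos_interval)
    have "integrable lborel (\<lambda>u. f (\<rho> * u))"
      using lborel_integrable_real_affine[OF f_int, of \<rho> 0] \<rho> by simp
    then have "integrable lborel (\<lambda>u. K (u / x) * (f (\<rho> * u) - R * f u))"
      using f_int by (intro integrable_K_mult) auto
    from integrable_mult_indicator[OF _ this, of "{x..<x'}"]
    show "integrable lborel (\<lambda>u. indicator {x..<x'} u *\<^sub>R (K (u / x) * (f (\<rho> * u) - R * f u)))" by simp
    show "0 \<le> indicator {x..<x'} u *\<^sub>R (K (u / x) * (f (\<rho> * u) - R * f u))" for u
      using w[of u] K_nonneg by (auto simp: indicator_def less_imp_le)
    show "x < min x' (b * x)" using x b_gt_1 by simp
    show "0 < indicator {x..<x'} u *\<^sub>R (K (u / x) * (f (\<rho> * u) - R * f u))" if "x < u" "u < min x' (b * x)" for u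
      using that w[of u] K_pos[of "u / x"] x by (auto simp: indicator_def field_simps)
  qed
  with * have "0 < f (\<rho> * x) / \<rho> - R * f x" by linarith
  then show ?thesis using f_pos[OF x'(1)] \<rho> by (simp add: R_def field_simps)
qed

end

section \<open>Unimodality and behaviour at zero\<close>

text \<open>The mode is a global maximum point, found on a compact interval outside of which
  \<open>F\<close> stays below \<open>F 1\<close>. A failure of monotonicity on either side would
  produce, by strict log-concavity, a value above this maximum.\<close>

lemma strictly_unimodal_ex_mode:
  fixes F :: "real \<Rightarrow> real"
  assumes pos: "\<And>x. 0 < x \<Longrightarrow> 0 < F x" and cont: "\<And>x. 0 < x \<Longrightarrow> isCont F x"
    and lim0: "(F \<longlongrightarrow> 0) (at_right 0)" and lim_inf: "(F \<longlongrightarrow> 0) at_top"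
    and strict: "\<And>x x' \<rho>. 0 < x \<Longrightarrow> x < x' \<Longrightarrow> 1 < \<rho> \<Longrightarrow> F x * F (\<rho> * x') < F (\<rho> * x) * F x'"
  shows "\<exists>m>0. strict_mono_on {0<..<m} F \<and> strict_antimono_on {m<..} F"
proof -
  have F1: "0 < F 1" by (simp add: pos)
  obtain a where a: "0 < a" "\<And>x. 0 < x \<Longrightarrow> x < a \<Longrightarrow> F x < F 1"
    using order_tendstoD(2)[OF lim0 F1] by (auto simp: eventually_at_right_field)
  obtain B where B: "\<And>x. B \<le> x \<Longrightarrow> F x < F 1"
    using order_tendstoD(2)[OF lim_inf F1] by (auto simp: eventually_at_top_linorder)
  define S where "S = {min a 1..max B 1}"
  have "continuous_on S F"
    using cont a(1) by (intro continuous_at_imp_continuous_on) (auto simp: S_def)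
  moreover have "compact S" "1 \<in> S" by (auto simp: S_def)
  ultimately obtain m where m: "m \<in> S" "\<And>x. x \<in> S \<Longrightarrow> F x \<le> F m"
    using continuous_attains_sup[of S F] by blast
  have m0: "0 < m" using m(1) a(1) by (auto simp: S_def)
  have max: "F x \<le> F m" if "0 < x" for x
  proof (cases "x \<in> S")
    case False
    then have "F x < F 1" using a(2)[of x] B[of x] that by (auto simp: S_def)
    then show ?thesis using m(2)[OF \<open>1 \<in> S\<close>] by simp
  qed (rule m)
  have "F x < F y" if "0 < x" "x < y" "y < m" for x y
  proof (rule ccontr)
    assume not: "\<not> F x < F y"
    \<comment> \<open>The ratio \<open>y / x\<close> sends \<open>x\<close> to \<open>y\<close> and
      \<open>m * x / y\<close> to \<open>m\<close>; the latter point exceeds \<open>x\<close>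
      because \<open>y < m\<close>.\<close>
    have "F x * F (y / x * (m * x / y)) < F (y / x * x) * F (m * x / y)"
      using that by (intro strict) (auto simp: field_simps)
    then have "F x * F m < F y * F (m * x / y)" using that by simp
    also have "\<dots> \<le> F x * F m"
      using not that m0 pos max by (intro mult_mono) (auto simp: less_imp_le)
    finally show False by simp
  qed
  moreover have "F y < F x" if "m < x" "x < y" for x y
  proof (rule ccontr)
    assume not: "\<not> F y < F x"
    have "F m * F x \<le> F m * F y"
      using not pos[OF m0] by (intro mult_left_mono) auto
    also have "\<dots> = F m * F (y / x * x)" using that m0 by simp
    \<comment> \<open>The same ratio, now applied to the pair \<open>m < x\<close>.\<close>
    also have "\<dots> < F (y / x * m) * F x" using that m0 by (intro strict) auto
    also have "\<dots> \<le> F m * F x" using that m0 pos max by (intro mult_right_mono) (auto simp: less_imp_le)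
    finally show False by simp
  qed
  ultimately show ?thesis using m0 by (intro exI[of _ m]) (auto simp: monotone_on_def)
qed

section \<open>Decay near zero and its logarithmic size\<close>

lemma minus_ln_le_powr:
  fixes x a :: real
  assumes "0 < x" "x \<le> 1" "0 < a"
  shows "- ln x \<le> x powr (- a) / a"
proof -
  have "(1 / x) powr a = x powr (- a)"
    using assms by (simp add: powr_divide powr_minus_divide)
  moreover have "ln (1 / x) = - ln x" using assms by (simp add: ln_div)
  ultimately show ?thesis using ln_powr_bound[of "1 / x" a] assms by simp
qed

text \<open>Each dilation by \<open>\<sigma>\<close> costs \<open>- ln (\<kappa> * x)\<close>, which
  is at most \<open>D * x powr (- a)\<close>, while \<open>x powr (- a)\<close> itself shrinks by
  the factor \<open>\<theta> < 1\<close>. A bound \<open>B * x powr (- a)\<close> therefore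
  reproduces itself as soon as \<open>B * \<theta> + D \<le> B\<close>.\<close>

lemma log_lower_bound_of_doubling:
  fixes F :: "real \<Rightarrow> real"
  assumes pos: "\<And>x. 0 < x \<Longrightarrow> 0 < F x" and mono: "strict_mono_on {0<..<m} F"
    and \<kappa>: "0 < \<kappa>" and \<sigma>: "1 < \<sigma>" and x1: "0 < x1" "x1 \<le> 1" "\<sigma> * x1 \<le> m" and a: "0 < a"
    and step: "\<And>x. 0 < x \<Longrightarrow> x < x1 \<Longrightarrow> \<kappa> * x * F (\<sigma> * x) \<le> F x"
  shows "\<exists>B. \<forall>x. 0 < x \<longrightarrow> x < x1 \<longrightarrow> - ln (F x) \<le> B * x powr (- a)"
proof -
  define \<theta> where "\<theta> = \<sigma> powr (- a)"
  have \<theta>: "0 < \<theta>" "\<theta> < 1"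
    using \<sigma> a powr_less_mono[of "- a" 0 \<sigma>] by (auto simp: \<theta>_def)
  define D where "D = 1 / a + \<bar>ln \<kappa>\<bar>"
  \<comment> \<open>Covers the starting range from \<open>x1\<close> to
    \<open>\<sigma> * x1\<close>, where monotonicity gives \<open>F x \<ge> F x1\<close>. The
    \<open>max\<close> with \<open>0\<close> allows for \<open>F x1 > 1\<close>.\<close>
  define B0 where "B0 = max 0 (- ln (F x1)) * (\<sigma> * x1) powr a"
  define B where "B = max B0 (D / (1 - \<theta>))"
  have BD: "B * \<theta> + D \<le> B"
  proof -
    have "D / (1 - \<theta>) \<le> B" by (simp add: B_def)
    then show ?thesis using \<theta> by (simp add: field_simps)
  qed
  have base: "- ln (F x) \<le> B * x powr (- a)" if "x1 \<le> x" "x < \<sigma> * x1" for x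
  proof -
    have x: "0 < x" using that x1 by simp
    have "F x1 \<le> F x"
      using mono that x1 by (cases "x1 = x") (auto simp: monotone_on_def less_imp_le)
    then have "- ln (F x) \<le> - ln (F x1)" using pos x1 x by simp
    also have "\<dots> \<le> max 0 (- ln (F x1)) * 1" by simp
    also have "\<dots> \<le> max 0 (- ln (F x1)) * ((\<sigma> * x1) powr a * x powr (- a))"
    proof (rule mult_left_mono)
      have "x powr a \<le> (\<sigma> * x1) powr a" using that x a by (intro powr_mono2) auto
      then have "x powr a * x powr (- a) \<le> (\<sigma> * x1) powr a * x powr (- a)" by (intro mult_right_mono) auto
      then show "1 \<le> (\<sigma> * x1) powr a * x powr (- a)" using x by (simp add: powr_minus)
    qed simp
    also have "\<dots> = B0 * x powr (- a)" by (simp add: B0_def)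
    also have "\<dots> \<le> B * x powr (- a)" by (intro mult_right_mono) (auto simp: B_def)
    finally show ?thesis .
  qed
  have "- ln (F x) \<le> B * x powr (- a)" if "0 < x" "x < \<sigma> * x1" "x1 \<le> \<sigma> ^ n * x" for n x
    using that
  proof (induction n arbitrary: x)
    case 0
    then show ?case using base by simp
  next
    case (Suc n)
    show ?case
    proof (cases "x1 \<le> x")
      case True
      then show ?thesis using base Suc.prems by simp
    next
      case False
      have IH: "- ln (F (\<sigma> * x)) \<le> B * (\<sigma> * x) powr (- a)"
        using Suc.prems False \<sigma> by (intro Suc.IH) (auto simp: mult_ac)
      have "ln (\<kappa> * x * F (\<sigma> * x)) \<le> ln (F x)"
        using step[of x] Suc.prems False \<kappa> pos \<sigma> by simp
      then have "- ln (F x) \<le> - ln \<kappa> - ln x - ln (F (\<sigma> * x))"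
        using \<kappa> Suc.prems pos[of "\<sigma> * x"] \<sigma> by (simp add: ln_mult)
      also have "- ln \<kappa> - ln x - ln (F (\<sigma> * x)) \<le> \<bar>ln \<kappa>\<bar> * x powr (- a) + x powr (- a) / a + B * (\<theta> * x powr (- a))"
      proof -
        have x: "x \<le> 1" using False x1 by simp
        then have "1 \<le> x powr (- a)" using Suc.prems a powr_mono2'[of "- a" x 1] by simp
        then have "\<bar>ln \<kappa>\<bar> * 1 \<le> \<bar>ln \<kappa>\<bar> * x powr (- a)" by (intro mult_left_mono) auto
        moreover have "- ln x \<le> x powr (- a) / a" using minus_ln_le_powr Suc.prems x a by simp
        moreover have "- ln (F (\<sigma> * x)) \<le> B * (\<theta> * x powr (- a))"
          using IH Suc.prems \<sigma> by (simp add: \<theta>_def powr_mult)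
        ultimately show ?thesis by linarith
      qed
      also have "\<dots> = (B * \<theta> + D) * x powr (- a)" by (simp add: D_def algebra_simps)
      also have "\<dots> \<le> B * x powr (- a)" by (intro mult_right_mono BD) auto
      finally show ?thesis .
    qed
  qed
  moreover have "\<exists>n. x1 \<le> \<sigma> ^ n * x" if "0 < x" for x
  proof -
    obtain n where "x1 / x < \<sigma> ^ n" using real_arch_pow[OF \<sigma>] by blast
    then show ?thesis using that by (intro exI[of _ n]) (simp add: field_simps)
  qed
  moreover have "x < \<sigma> * x1" if "x < x1" for x
  proof -
    have "1 * x1 \<le> \<sigma> * x1" using \<sigma> x1 by (intro mult_right_mono) auto
    then show ?thesis using that by simp
  qed
  ultimately show ?thesis by blast
qed

context kernel_density
begin

text \<open>The kernel lives on an interval of length \<open>(b - 1) * x\<close>, so each use of the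
  equation gains one power of \<open>x\<close>.\<close>

lemma f_le_power: "\<exists>B\<ge>0. \<forall>x>0. f x \<le> B * x ^ n"
proof (induction n)
  case 0
  have "f x \<le> (LINT u|lborel. f u)" if "0 < x" for x
    unfolding f_eq[OF that] using K_nonneg K_le_1 f_nonneg
    by (intro integral_mono integrable_K_mult f_int) (auto intro!: mult_left_le_one_le)
  then show ?case using f_mass by (intro exI[of _ "LINT u|lborel. f u"]) auto
next
  case (Suc n)
  then obtain B where B: "0 \<le> B" "\<And>x. 0 < x \<Longrightarrow> f x \<le> B * x ^ n" by blast
  have "f x \<le> (B * b ^ n * (b - 1)) * x ^ Suc n" if x: "0 < x" for x
  proof -
    have le: "x \<le> b * x" using x b_gt_1 by simp
    have i: "integrable lborel (\<lambda>u. indicator {x..b * x} u * (B * (b * x) ^ n))"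
      using le by (intro integrable_mult_left integrable_real_indicator) (auto simp: emeasure_lborel_Icc)
    have "f x = (LINT u|lborel. K (u / x) * f u)" by (rule f_eq[OF x])
    also have "\<dots> \<le> (LINT u|lborel. indicator {x..b * x} u * (B * (b * x) ^ n))"
    proof (intro integral_mono integrable_K_mult f_int i)
      fix u
      consider "u < x" | "x \<le> u" "u \<le> b * x" | "b * x < u" by linarith
      then show "K (u / x) * f u \<le> indicator {x..b * x} u * (B * (b * x) ^ n)"
      proof cases
        case 1
        then show ?thesis using x K_eq_0[of "u / x"] by simp
      next
        case 2
        have "K (u / x) * f u \<le> 1 * (B * u ^ n)"
          using 2 x by (intro mult_mono K_le_1 B f_nonneg) auto
        also have "\<dots> \<le> B * (b * x) ^ n"
          using 2 x B by (auto intro!: mult_left_mono power_mono)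
        finally show ?thesis using 2 by simp
      next
        case 3
        then show ?thesis using x K_eq_0[of "u / x"] by (simp add: field_simps)
      qed
    qed
    also have "\<dots> = (b * x - x) * (B * (b * x) ^ n)" using le by simp
    finally show ?thesis by (simp add: power_mult_distrib algebra_simps)
  qed
  then show ?case using B b_gt_1 by (intro exI[of _ "B * b ^ n * (b - 1)"]) auto
qed

lemma f_tendsto_0: "(f \<longlongrightarrow> 0) (at_right 0)" "(f \<longlongrightarrow> 0) at_top"
proof -
  obtain B where B: "\<And>x. 0 < x \<Longrightarrow> f x \<le> B * x ^ 1" using f_le_power[of 1] by blast
  show "(f \<longlongrightarrow> 0) (at_right 0)"
  proof (rule tendsto_sandwich[OF _ _ tendsto_const])
    show "\<forall>\<^sub>F x in at_right 0. f x \<le> B * x"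
      using eventually_at_right_less[of "0::real"] by eventually_elim (use B in auto)
    show "((\<lambda>x. B * x) \<longlongrightarrow> 0) (at_right 0)"
      by (intro tendsto_mult_right_zero tendsto_ident_at)
  qed (simp add: f_nonneg)
  obtain c where c: "0 < c" "\<And>x. 0 < x \<Longrightarrow> f x \<le> c * (x powr \<beta> * exp (- x))"
    using f_asymptotics by blast
  show "(f \<longlongrightarrow> 0) at_top"
  proof (rule tendsto_sandwich[OF _ _ tendsto_const])
    show "\<forall>\<^sub>F x in at_top. f x \<le> c * (2 * \<beta>) powr \<beta> * exp (- (x / 2))"
      using eventually_gt_at_top[of 0]
    proof eventually_elim
      case (elim x)
      have "f x \<le> c * ((2 * \<beta>) powr \<beta> * exp (x / 2) * exp (- x))"
        using c(2)[OF elim] c(1) powr_le_exp_half[OF elim \<beta>_pos]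
        by (elim order_trans) (auto intro!: mult_left_mono mult_right_mono)
      also have "\<dots> = c * (2 * \<beta>) powr \<beta> * exp (x / 2 + - x)" by (simp only: exp_add mult.assoc)
      finally show ?case by simp
    qed
    have "filterlim (\<lambda>x::real. x / 2) at_top at_top"
      by (rule filterlim_at_top_mult_tendsto_pos[OF tendsto_const _ filterlim_ident, of "1/2", simplified])
    then have "((\<lambda>x::real. exp (- (x / 2))) \<longlongrightarrow> 0) at_top"
      by (intro filterlim_compose[OF exp_at_bot] filterlim_uminus_at_bot_at_top[THEN filterlim_compose])
    then show "((\<lambda>x. c * (2 * \<beta>) powr \<beta> * exp (- (x / 2))) \<longlongrightarrow> 0) at_top"
      by (rule tendsto_mult_right_zero)
  qed (simp add: f_nonneg)
qed

text \<open>Left of the mode \<open>f\<close> increases, so its integral against the kernel over the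
  upper part \<open>[\<sigma> * x, b * x]\<close> of the window is at least
  \<open>\<kappa> * x * f (\<sigma> * x)\<close>. This is the hypothesis of the dilation
  argument.\<close>

lemma ln_f_tendsto_0:
  assumes a: "0 < a"
  shows "((\<lambda>x. x powr a * ln (f x)) \<longlongrightarrow> 0) (at_right 0)"
proof -
  obtain m where m: "0 < m" and mono: "strict_mono_on {0<..<m} f"
    using strictly_unimodal_ex_mode[OF f_pos f_isCont f_tendsto_0 f_strict] by blast
  \<comment> \<open>Strictly between \<open>1\<close> and \<open>b\<close>: above \<open>1\<close>
    for a genuine dilation, below \<open>b\<close> so that the kernel has mass
    \<open>\<kappa> > 0\<close> on \<open>[\<sigma>, b]\<close>.\<close>
  define \<sigma> where "\<sigma> = (1 + b) / 2"
  have \<sigma>: "1 < \<sigma>" "\<sigma> < b" using b_gt_1 by (auto simp: \<sigma>_def)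
  \<comment> \<open>Keeps the whole window up to \<open>b * x\<close> in the region where
    \<open>f\<close> increases.\<close>
  define x1 where "x1 = min 1 (m / b)"
  have x1: "0 < x1" "x1 \<le> 1" "b * x1 \<le> m" using m b_gt_1 by (auto simp: x1_def min_def field_simps)
  have "\<sigma> * x1 \<le> b * x1" using \<sigma> x1 by (intro mult_right_mono) auto
  then have \<sigma>x1: "\<sigma> * x1 \<le> m" using x1 by linarith
  define \<kappa> where "\<kappa> = (LINT t|lborel. indicator {\<sigma>..b} t * K t)"
  have iK: "integrable lborel (\<lambda>t. indicator {\<sigma>..b} t * K t)"
  proof (rule Bochner_Integration.integrable_bound)
    show "integrable lborel (indicator {\<sigma>..b} :: real \<Rightarrow> real)"
      by (rule integrable_real_indicator) (use \<sigma> in auto)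
  qed (use K_nonneg K_le_1 in \<open>auto simp: indicator_def\<close>)
  have \<kappa>: "0 < \<kappa>"
    unfolding \<kappa>_def by (rule integral_pos_interval[OF iK _ \<sigma>(2)]) (use \<sigma> K_nonneg in \<open>auto intro: K_pos\<close>)
  have step: "\<kappa> * x * f (\<sigma> * x) \<le> f x" if x: "0 < x" "x < x1" for x
  proof -
    have bx: "b * x < m" using x x1 b_gt_1 by (smt (verit) mult_strict_left_mono)
    have "\<kappa> * x = (LINT u|lborel. indicator {\<sigma>..b} (u / x) * K (u / x))"
      unfolding \<kappa>_def using x lborel_integral_real_affine[of x "\<lambda>u. indicator {\<sigma>..b} (u / x) * K (u / x)" 0]
      by simp
    moreover have "(LINT u|lborel. indicator {\<sigma>..b} (u / x) * K (u / x) * f (\<sigma> * x)) \<le> (LINT u|lborel. K (u / x) * f u)"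
    proof (intro integral_mono integrable_K_mult f_int integrable_mult_left)
      show "integrable lborel (\<lambda>u. indicator {\<sigma>..b} (u / x) * K (u / x))"
        using lborel_integrable_real_affine[OF iK, of "1 / x" 0] x by simp
      fix u
      show "indicator {\<sigma>..b} (u / x) * K (u / x) * f (\<sigma> * x) \<le> K (u / x) * f u"
      proof (cases "\<sigma> * x \<le> u \<and> u \<le> b * x")
        case True
        moreover have "0 < \<sigma> * x" using \<sigma> x by simp
        ultimately have "f (\<sigma> * x) \<le> f u"
          using mono bx by (cases "\<sigma> * x = u") (auto simp: monotone_on_def less_imp_le)
        then show ?thesis using K_nonneg f_nonneg by (auto simp: indicator_def mult_left_mono)
      next
        case False
        then have "u / x \<notin> {\<sigma>..b}" using x by (auto simp: field_simps)
        then show ?thesis using K_nonneg f_nonneg by simp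
      qed
    qed
    ultimately show ?thesis using f_eq[OF x(1)] by simp
  qed
  \<comment> \<open>Half the exponent is spent on the logarithm; the remaining factor
    \<open>x powr (a / 2)\<close> drives the product to \<open>0\<close>.\<close>
  have a2: "0 < a / 2" using a by simp
  obtain B where B: "\<And>x. 0 < x \<Longrightarrow> x < x1 \<Longrightarrow> - ln (f x) \<le> B * x powr (- (a / 2))"
    using log_lower_bound_of_doubling[OF f_pos mono \<kappa> \<sigma>(1) x1(1,2) \<sigma>x1 a2 step] by blast
  show ?thesis
  proof (rule tendsto_sandwich[OF _ _ _ tendsto_const])
    show "\<forall>\<^sub>F x in at_right 0. - B * x powr (a / 2) \<le> x powr a * ln (f x)"
      using eventually_at_right_less[of 0] eventually_at_right_real[OF x1(1)]
    proof eventually_elim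
      case (elim x)
      then have "x powr a * (- ln (f x)) \<le> x powr a * (B * x powr (- (a / 2)))"
        by (intro mult_left_mono B) auto
      also have "\<dots> = B * x powr (a + - (a / 2))" by (simp only: powr_add mult_ac)
      finally show ?case by simp
    qed
    show "\<forall>\<^sub>F x in at_right 0. x powr a * ln (f x) \<le> 0"
      using eventually_at_right_less[of 0] order_tendstoD(2)[OF f_tendsto_0(1) zero_less_one]
      by eventually_elim (use f_pos in \<open>auto intro!: mult_nonneg_nonpos\<close>)
    have "((\<lambda>x. x powr (a / 2)) \<longlongrightarrow> 0 powr (a / 2)) (at_right 0)"
      using a by (intro tendsto_powr' tendsto_ident_at tendsto_const)
        (auto intro: eventually_mono[OF eventually_at_right_less])
    then show "((\<lambda>x. - B * x powr (a / 2)) \<longlongrightarrow> 0) (at_right 0)"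
      by (intro tendsto_mult_right_zero) simp
  qed
qed

end

section \<open>The kernel of the \<open>\<alpha>\<close>-sun equation\<close>

text \<open>The substitution itself takes place for the completed measure; \<open>meas\<close>
  brings the transformed integrand back to \<open>lborel\<close>.\<close>

lemma lborel_change_of_variables:
  fixes F g g' :: "real \<Rightarrow> real"
  assumes S: "S \<in> sets borel" and F: "set_integrable lborel (g ` S) F"
    and deriv: "\<And>w. w \<in> S \<Longrightarrow> (g has_field_derivative g' w) (at w within S)"
    and inj: "inj_on g S" and nonneg: "\<And>w. w \<in> S \<Longrightarrow> 0 \<le> g' w"
    and meas: "(\<lambda>w. indicator S w *\<^sub>R (g' w * F (g w))) \<in> borel_measurable borel"
  shows "set_integrable lborel S (\<lambda>w. g' w * F (g w))"
    and "(LINT w:S|lborel. g' w * F (g w)) = (LINT u:g ` S|lborel. F u)"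
proof -
  have F': "F absolutely_integrable_on g ` S"
    using F unfolding set_integrable_def
    by (subst integrable_completion) (auto dest: borel_measurable_integrable)
  have "(\<lambda>w. \<bar>g' w\<bar> * F (g w)) absolutely_integrable_on S \<and>
     integral S (\<lambda>w. \<bar>g' w\<bar> * F (g w)) = integral (g ` S) F"
    using has_absolute_integral_change_of_variables_1'[OF _ deriv inj, of F "integral (g ` S) F"] F' S by simp
  moreover have "(\<lambda>w. \<bar>g' w\<bar> * F (g w)) absolutely_integrable_on S \<longleftrightarrow> (\<lambda>w. g' w * F (g w)) absolutely_integrable_on S"
    unfolding set_integrable_def using nonneg
    by (intro Bochner_Integration.integrable_cong) (auto simp: indicator_def)
  moreover have "integral S (\<lambda>w. \<bar>g' w\<bar> * F (g w)) = integral S (\<lambda>w. g' w * F (g w))"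
    using nonneg by (intro integral_cong) auto
  ultimately have *: "(\<lambda>w. g' w * F (g w)) absolutely_integrable_on S"
     "integral S (\<lambda>w. g' w * F (g w)) = integral (g ` S) F" by auto
  show si: "set_integrable lborel S (\<lambda>w. g' w * F (g w))"
    using *(1) unfolding set_integrable_def by (subst (asm) integrable_completion) (use meas in auto)
  show "(LINT w:S|lborel. g' w * F (g w)) = (LINT u:g ` S|lborel. F u)"
    using set_borel_integral_eq_integral(2)[OF si] set_borel_integral_eq_integral(2)[OF F] *(2) by simp
qed

text \<open>The factor \<open>(x - \<alpha> * u) powr \<gamma>\<close> of the sun equation in the
  new variables, normalised to \<open>1\<close> at \<open>t = 1\<close>. The \<open>max\<close> with
  \<open>0\<close> makes it vanish from \<open>t = \<alpha> powr (- \<gamma>)\<close> on, where the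
  base stops being positive.\<close>

definition sun_kernel :: "real \<Rightarrow> real \<Rightarrow> real \<Rightarrow> real" where
  "sun_kernel \<alpha> \<gamma> t = (if 1 \<le> t then max 0 ((1 - \<alpha> * t powr (1 / \<gamma>)) / (1 - \<alpha>)) powr \<gamma> else 0)"

context
  fixes \<alpha> \<gamma> :: real
  assumes \<alpha>: "0 < \<alpha>" "\<alpha> < 1" and \<gamma>: "0 < \<gamma>"
begin

abbreviation (input) "sun_b \<equiv> \<alpha> powr (- \<gamma>)"
abbreviation (input) "sun_\<beta> \<equiv> \<alpha> / (1 - \<alpha>)"

lemma sun_b_gt_1: "1 < sun_b"
  using powr_less_mono2_neg[of "- \<gamma>" \<alpha> 1] \<alpha> \<gamma> by simp

lemma sun_b_root: "sun_b powr (1 / \<gamma>) = 1 / \<alpha>"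
proof -
  have "sun_b powr (1 / \<gamma>) = \<alpha> powr (- \<gamma> * (1 / \<gamma>))" by (rule powr_powr)
  also have "\<dots> = 1 / \<alpha>" using \<alpha> \<gamma> by (simp add: powr_minus_divide)
  finally show ?thesis .
qed

lemma sun_kernel_eq:
  assumes "1 \<le> t" "t < sun_b"
  shows "\<alpha> * t powr (1 / \<gamma>) < 1"
    and "sun_kernel \<alpha> \<gamma> t = ((1 - \<alpha> * t powr (1 / \<gamma>)) / (1 - \<alpha>)) powr \<gamma>"
proof -
  have "t powr (1 / \<gamma>) < sun_b powr (1 / \<gamma>)"
    using assms \<gamma> by (intro powr_less_mono2) auto
  also have "\<dots> = 1 / \<alpha>" by (rule sun_b_root)
  finally show *: "\<alpha> * t powr (1 / \<gamma>) < 1" using \<alpha> by (simp add: field_simps)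
  then show "sun_kernel \<alpha> \<gamma> t = ((1 - \<alpha> * t powr (1 / \<gamma>)) / (1 - \<alpha>)) powr \<gamma>"
    using \<alpha> assms by (simp add: sun_kernel_def max_def)
qed

lemma sun_kernel_eq_0: "t < 1 \<or> sun_b \<le> t \<Longrightarrow> sun_kernel \<alpha> \<gamma> t = 0"
proof (cases "1 \<le> t")
  case True
  assume "t < 1 \<or> sun_b \<le> t"
  then have "sun_b \<le> t" using True by simp
  then have "sun_b powr (1 / \<gamma>) \<le> t powr (1 / \<gamma>)"
    using \<gamma> by (intro powr_mono2) auto
  then have "1 / \<alpha> \<le> t powr (1 / \<gamma>)" by (simp only: sun_b_root)
  then have "1 \<le> \<alpha> * t powr (1 / \<gamma>)" using \<alpha> by (simp add: field_simps)
  then have "(1 - \<alpha> * t powr (1 / \<gamma>)) / (1 - \<alpha>) \<le> 0" using \<alpha> by (simp add: divide_nonpos_pos)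
  then show ?thesis using True by (simp add: sun_kernel_def)
qed (simp add: sun_kernel_def)

lemma sun_kernel_nonneg: "0 \<le> sun_kernel \<alpha> \<gamma> t"
  by (simp add: sun_kernel_def)

lemma sun_kernel_isCont: assumes "t \<noteq> 1" shows "isCont (sun_kernel \<alpha> \<gamma>) t"
proof (cases "t < 1")
  case True
  then have "\<forall>\<^sub>F s in nhds t. sun_kernel \<alpha> \<gamma> s = 0"
    by (auto simp: sun_kernel_def eventually_nhds intro!: exI[of _ "{..<1}"])
  then show ?thesis by (subst isCont_cong) auto
next
  case False
  then have t: "1 < t" using assms by simp
  have "\<forall>\<^sub>F s in nhds t. sun_kernel \<alpha> \<gamma> s = max 0 ((1 - \<alpha> * s powr (1 / \<gamma>)) / (1 - \<alpha>)) powr \<gamma>"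
    using t by (auto simp: sun_kernel_def eventually_nhds intro!: exI[of _ "{1<..}"])
  \<comment> \<open>At the right end of the support the base tends to \<open>0\<close>; as
    \<open>\<gamma> > 0\<close>, the power is continuous there too.\<close>
  moreover have "isCont (\<lambda>s. max 0 ((1 - \<alpha> * s powr (1 / \<gamma>)) / (1 - \<alpha>)) powr \<gamma>) t"
    unfolding isCont_def using t \<gamma> \<alpha>
    by (intro tendsto_powr' tendsto_max tendsto_intros) auto
  ultimately show ?thesis by (subst isCont_cong) auto
qed

text \<open>In logarithmic coordinates this is log-concavity of the kernel. With \<open>s\<close>
  for the smallest ratio and dilations \<open>A\<close> and \<open>B\<close>, all raised to
  \<open>1 / \<gamma>\<close>, the inequality reduces to
  \<open>(A - 1) * (B - 1) \<ge> 0\<close>.\<close>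

lemma sun_kernel_tp2:
  assumes x: "0 < x" "x \<le> x'" and u: "u \<le> v"
  shows "sun_kernel \<alpha> \<gamma> (v / x) * sun_kernel \<alpha> \<gamma> (u / x') \<le> sun_kernel \<alpha> \<gamma> (u / x) * sun_kernel \<alpha> \<gamma> (v / x')"
proof (cases "1 \<le> u / x' \<and> v / x < sun_b")
  case False
  \<comment> \<open>The left side involves the largest ratio \<open>v / x\<close> and the smallest
    ratio \<open>u / x'\<close>. If one of them misses the support the left side vanishes; otherwise
    all four ratios lie in it.\<close>
  then have "v / x < 1 \<or> sun_b \<le> v / x \<or> u / x' < 1" by auto
  then have "sun_kernel \<alpha> \<gamma> (v / x) * sun_kernel \<alpha> \<gamma> (u / x') = 0"
    using sun_kernel_eq_0 by auto
  then show ?thesis by (metis mult_nonneg_nonneg sun_kernel_nonneg)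
next
  case True
  then have "x' \<le> u" using x by (simp add: field_simps)
  then have pos: "0 < x'" "0 < u" "0 < v" using x u by auto
  have le: "u / x' \<le> u / x" "u / x' \<le> v / x'" "u / x \<le> v / x" "v / x' \<le> v / x"
    using x u pos by (auto intro: divide_left_mono divide_right_mono)
  define s where "s = (u / x') powr (1 / \<gamma>)"
  define A where "A = (x' / x) powr (1 / \<gamma>)"
  define B where "B = (v / u) powr (1 / \<gamma>)"
  have AB: "1 \<le> A" "1 \<le> B" "1 \<le> s"
    using x u pos True \<gamma> by (auto simp: A_def B_def s_def intro!: ge_one_powr_ge_zero)
  have e: "(u / x) powr (1 / \<gamma>) = s * A" "(v / x') powr (1 / \<gamma>) = s * B" "(v / x) powr (1 / \<gamma>) = s * A * B"
    using x pos by (auto simp: s_def A_def B_def powr_mult[symmetric])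
  note K = sun_kernel_eq[of "u / x"] sun_kernel_eq[of "v / x"] sun_kernel_eq[of "u / x'"] sun_kernel_eq[of "v / x'"]
  have k: "\<alpha> * (s * A) < 1" "\<alpha> * (s * A * B) < 1" "\<alpha> * s < 1" "\<alpha> * (s * B) < 1"
    using K le True by (auto simp: e s_def[symmetric])
  have "0 \<le> (A - 1) * (B - 1)" using AB by simp
  then have "\<alpha> * s * (A + B) \<le> \<alpha> * s * (A * B + 1)"
    using \<alpha> AB by (intro mult_left_mono) (auto simp: algebra_simps)
  then have "(1 - \<alpha> * (s * A * B)) * (1 - \<alpha> * s) \<le> (1 - \<alpha> * (s * A)) * (1 - \<alpha> * (s * B))"
    by (simp add: algebra_simps)
  then have ineq: "((1 - \<alpha> * (s * A * B)) / (1 - \<alpha>)) * ((1 - \<alpha> * s) / (1 - \<alpha>)) \<le>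
      ((1 - \<alpha> * (s * A)) / (1 - \<alpha>)) * ((1 - \<alpha> * (s * B)) / (1 - \<alpha>))"
    using \<alpha> by (simp add: divide_right_mono)
  define P Q R W where "P = (1 - \<alpha> * (s * A * B)) / (1 - \<alpha>)" and "Q = (1 - \<alpha> * s) / (1 - \<alpha>)"
    and "R = (1 - \<alpha> * (s * A)) / (1 - \<alpha>)" and "W = (1 - \<alpha> * (s * B)) / (1 - \<alpha>)"
  have nn: "0 \<le> P" "0 \<le> Q" "0 \<le> R" "0 \<le> W"
    using k \<alpha> by (auto simp: P_def Q_def R_def W_def)
  have "P * Q \<le> R * W" using ineq by (simp only: P_def Q_def R_def W_def)
  then have "(P * Q) powr \<gamma> \<le> (R * W) powr \<gamma>"
    using \<gamma> nn by (intro powr_mono2) auto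
  then have "P powr \<gamma> * Q powr \<gamma> \<le> R powr \<gamma> * W powr \<gamma>"
    using nn by (simp add: powr_mult)
  moreover have "sun_kernel \<alpha> \<gamma> (v / x) = P powr \<gamma>" "sun_kernel \<alpha> \<gamma> (u / x') = Q powr \<gamma>"
    "sun_kernel \<alpha> \<gamma> (u / x) = R powr \<gamma>" "sun_kernel \<alpha> \<gamma> (v / x') = W powr \<gamma>"
    using K le True by (auto simp: e s_def[symmetric] P_def Q_def R_def W_def)
  ultimately show ?thesis by simp
qed

text \<open>\<open>ln y \<le> y - 1\<close> is used twice, for the base of the kernel and for
  \<open>\<tau>\<close>; the two linear expressions match exactly because of the value of
  \<open>\<beta>\<close>.\<close>

lemma sun_kernel_upper:
  assumes t: "1 \<le> t"
  shows "sun_kernel \<alpha> \<gamma> t \<le> t powr (- sun_\<beta>)"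
proof (cases "t < sun_b")
  case True
  define \<tau> where "\<tau> = t powr (1 / \<gamma>)"
  have \<tau>: "1 \<le> \<tau>" using t \<gamma> by (simp add: \<tau>_def ge_one_powr_ge_zero)
  have k: "\<alpha> * \<tau> < 1" using sun_kernel_eq(1)[OF t True] by (simp add: \<tau>_def)
  have "ln ((1 - \<alpha> * \<tau>) / (1 - \<alpha>)) \<le> (1 - \<alpha> * \<tau>) / (1 - \<alpha>) - 1"
    using k \<alpha> by (intro ln_le_minus_one) auto
  also have "\<dots> = sun_\<beta> * (- (\<tau> - 1))" using \<alpha> by (simp add: field_simps)
  also have "\<dots> \<le> sun_\<beta> * (- ln \<tau>)"
    using \<alpha> \<tau> ln_le_minus_one[of \<tau>] by (intro mult_left_mono) auto
  finally have "\<gamma> * ln ((1 - \<alpha> * \<tau>) / (1 - \<alpha>)) \<le> \<gamma> * (sun_\<beta> * (- ln \<tau>))"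
    using \<gamma> by (intro mult_left_mono) auto
  also have "\<dots> = - sun_\<beta> * ln t" using t \<gamma> by (simp add: \<tau>_def ln_powr)
  finally have "exp (\<gamma> * ln ((1 - \<alpha> * \<tau>) / (1 - \<alpha>))) \<le> exp (- sun_\<beta> * ln t)" by simp
  moreover have "sun_kernel \<alpha> \<gamma> t = exp (\<gamma> * ln ((1 - \<alpha> * \<tau>) / (1 - \<alpha>)))"
    using k \<alpha> by (simp add: sun_kernel_eq(2)[OF t True] \<tau>_def[symmetric] powr_def[of "(1 - \<alpha> * \<tau>) / (1 - \<alpha>)"])
  moreover have "t powr (- sun_\<beta>) = exp (- sun_\<beta> * ln t)" using t by (simp add: powr_def)
  ultimately show ?thesis by (simp only:)
qed (simp add: sun_kernel_eq_0)

text \<open>A second order Taylor bound for the logarithm of the kernel at \<open>t = 1\<close>.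
  Away from \<open>1\<close> nothing has to be estimated: a large constant makes the left side
  nonpositive.\<close>

lemma sun_kernel_lower:
  "\<exists>C\<ge>0. \<forall>t\<ge>1. t powr (- sun_\<beta>) * (1 - C * (1 - 1 / t)\<^sup>2) \<le> sun_kernel \<alpha> \<gamma> t"
proof -
  define \<beta> where "\<beta> = sun_\<beta>"
  have \<beta>: "0 < \<beta>" using \<alpha> by (simp add: \<beta>_def)
  \<comment> \<open>A Lipschitz constant: \<open>\<tau> - 1 \<le> E * (1 - 1 / t)\<close> on the
    support.\<close>
  define E where "E = sun_b / (\<alpha> * \<gamma>)"
  have E: "0 < E" using \<alpha> \<gamma> by (simp add: E_def)
  define C1 where "C1 = \<gamma> * (2 * \<beta>\<^sup>2 + \<beta>) * E\<^sup>2"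
  define C2 where "C2 = (2 * \<beta> * E)\<^sup>2"
  define C3 where "C3 = 1 / (1 - 1 / sun_b)\<^sup>2"
  have C: "0 \<le> C1" "0 \<le> C2" "0 \<le> C3" using \<beta> \<gamma> by (auto simp: C1_def C2_def C3_def)
  have "t powr (- \<beta>) * (1 - (C1 + C2 + C3) * (1 - 1 / t)\<^sup>2) \<le> sun_kernel \<alpha> \<gamma> t" if t: "1 \<le> t" for t
  proof -
    define z where "z = 1 - 1 / t"
    have z: "0 \<le> z" using t by (simp add: z_def)
    have triv: ?thesis if "1 \<le> (C1 + C2 + C3) * z\<^sup>2"
      using that by (intro order_trans[OF mult_nonneg_nonpos sun_kernel_nonneg]) (auto simp: z_def)
    show ?thesis
    proof (cases "t < sun_b")
      case False
      have "1 / t \<le> 1 / sun_b" using False sun_b_gt_1 t by (intro divide_left_mono mult_pos_pos) linarith+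
      moreover have "1 / sun_b < 1" using sun_b_gt_1 by (subst divide_less_eq_1_pos) auto
      ultimately have "(1 - 1 / sun_b)\<^sup>2 \<le> z\<^sup>2"
        unfolding z_def by (intro power_mono) linarith+
      moreover have "0 < (1 - 1 / sun_b)\<^sup>2" using sun_b_gt_1 by simp
      ultimately have "1 \<le> C3 * z\<^sup>2" by (simp add: C3_def field_simps)
      also have "\<dots> \<le> (C1 + C2 + C3) * z\<^sup>2" using C by (intro mult_right_mono) auto
      finally show ?thesis by (rule triv)
    next
      case True
      define \<tau> where "\<tau> = t powr (1 / \<gamma>)"
      have \<tau>: "1 \<le> \<tau>" using t \<gamma> by (simp add: \<tau>_def ge_one_powr_ge_zero)
      have k: "\<alpha> * \<tau> < 1" using sun_kernel_eq(1)[OF t True] by (simp add: \<tau>_def)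
      have \<tau>E: "\<tau> - 1 \<le> E * z"
      proof -
        have "1 - 1 / \<tau> \<le> ln \<tau>" using ln_le_minus_one[of "1 / \<tau>"] \<tau> by (simp add: ln_div)
        then have "\<tau> * (1 - 1 / \<tau>) \<le> \<tau> * ln \<tau>" using \<tau> by (intro mult_left_mono) auto
        then have "\<tau> - 1 \<le> \<tau> * ln \<tau>" using \<tau> by (simp add: right_diff_distrib)
        also have "\<tau> * ln \<tau> \<le> (1 / \<alpha>) * ((t - 1) / \<gamma>)"
        proof (intro mult_mono)
          show "\<tau> \<le> 1 / \<alpha>" using k \<alpha> by (simp add: field_simps)
          have "ln \<tau> = ln t / \<gamma>" using t by (simp add: \<tau>_def ln_powr)
          then show "ln \<tau> \<le> (t - 1) / \<gamma>" using t \<gamma> ln_le_minus_one[of t] by (simp add: divide_right_mono)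
        qed (use \<tau> \<alpha> in auto)
        also have "t - 1 = t * z" using t by (simp add: z_def right_diff_distrib)
        also have "1 / \<alpha> * (t * z / \<gamma>) = t * z / (\<alpha> * \<gamma>)" by simp
        also have "\<dots> \<le> sun_b * z / (\<alpha> * \<gamma>)"
          using True z \<alpha> \<gamma> by (intro divide_right_mono mult_right_mono) auto
        finally show ?thesis by (simp add: E_def)
      qed
      show ?thesis
      proof (cases "\<beta> * (\<tau> - 1) \<le> 1 / 2")
        case False
        have "\<beta> * (\<tau> - 1) \<le> \<beta> * (E * z)" using \<tau>E \<beta> by (intro mult_left_mono) auto
        then have "1 \<le> 2 * \<beta> * E * z" using False by simp
        then have "1\<^sup>2 \<le> (2 * \<beta> * E * z)\<^sup>2" by (intro power_mono) auto
        also have "\<dots> = C2 * z\<^sup>2" by (simp add: C2_def power_mult_distrib)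
        also have "\<dots> \<le> (C1 + C2 + C3) * z\<^sup>2" using C by (intro mult_right_mono) auto
        finally show ?thesis by (intro triv) simp
      next
        case near: True
        define y where "y = \<beta> * (\<tau> - 1)"
        have y: "0 \<le> y" "y \<le> 1 / 2" using near \<beta> \<tau> by (auto simp: y_def)
        have ky: "(1 - \<alpha> * \<tau>) / (1 - \<alpha>) = 1 - y" using \<alpha> by (simp add: y_def \<beta>_def field_simps)
        have l1: "- y - 2 * y\<^sup>2 \<le> ln (1 - y)"
          by (rule ln_one_minus_pos_lower_bound[OF y])
        have l2: "(\<tau> - 1) - (\<tau> - 1)\<^sup>2 \<le> ln \<tau>"
        proof -
          have "(\<tau> - 1) * (1 - (\<tau> - 1)) \<le> 1 - 1 / \<tau>"
          proof -
            have "0 \<le> (\<tau> - 1) * (\<tau> - 1)\<^sup>2" using \<tau> by simp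
            then show ?thesis using \<tau> by (simp add: field_simps power2_eq_square)
          qed
          also have "\<dots> \<le> ln \<tau>" using ln_le_minus_one[of "1 / \<tau>"] \<tau> by (simp add: ln_div)
          finally show ?thesis by (simp add: algebra_simps power2_eq_square)
        qed
        have ysq: "y\<^sup>2 = \<beta>\<^sup>2 * (\<tau> - 1)\<^sup>2" by (simp add: y_def power_mult_distrib)
        \<comment> \<open>The linear terms \<open>- y\<close> and
          \<open>\<beta> * (\<tau> - 1)\<close> cancel, leaving only second order terms.\<close>
        have "- (2 * \<beta>\<^sup>2 + \<beta>) * (\<tau> - 1)\<^sup>2 = - y - 2 * y\<^sup>2 + \<beta> * ((\<tau> - 1) - (\<tau> - 1)\<^sup>2)"
          unfolding ysq by (simp add: y_def algebra_simps)
        also have "\<dots> \<le> ln (1 - y) + \<beta> * ln \<tau>"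
          using l1 l2 \<beta> by (intro add_mono mult_left_mono) auto
        finally have "\<gamma> * (- (2 * \<beta>\<^sup>2 + \<beta>) * (\<tau> - 1)\<^sup>2) \<le> \<gamma> * (ln (1 - y) + \<beta> * ln \<tau>)"
          using \<gamma> by (intro mult_left_mono) auto
        also have "\<dots> = \<gamma> * ln (1 - y) + \<beta> * ln t" using t \<gamma> by (simp add: \<tau>_def ln_powr algebra_simps)
        finally have low: "- (\<gamma> * (2 * \<beta>\<^sup>2 + \<beta>) * (\<tau> - 1)\<^sup>2) - \<beta> * ln t \<le> \<gamma> * ln (1 - y)"
          by (simp add: algebra_simps)
        have "\<gamma> * (2 * \<beta>\<^sup>2 + \<beta>) * (\<tau> - 1)\<^sup>2 \<le> \<gamma> * (2 * \<beta>\<^sup>2 + \<beta>) * (E * z)\<^sup>2"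
          using \<tau>E \<tau> \<beta> \<gamma> by (intro mult_left_mono power_mono) auto
        also have "\<dots> = C1 * z\<^sup>2" by (simp add: C1_def power_mult_distrib)
        also have "\<dots> \<le> (C1 + C2 + C3) * z\<^sup>2" using C by (intro mult_right_mono) auto
        finally have "1 - (C1 + C2 + C3) * z\<^sup>2 \<le> 1 + - (\<gamma> * (2 * \<beta>\<^sup>2 + \<beta>) * (\<tau> - 1)\<^sup>2)" by simp
        also have "\<dots> \<le> exp (- (\<gamma> * (2 * \<beta>\<^sup>2 + \<beta>) * (\<tau> - 1)\<^sup>2))" by (rule exp_ge_add_one_self)
        finally have "t powr (- \<beta>) * (1 - (C1 + C2 + C3) * z\<^sup>2) \<le>
            t powr (- \<beta>) * exp (- (\<gamma> * (2 * \<beta>\<^sup>2 + \<beta>) * (\<tau> - 1)\<^sup>2))" by (intro mult_left_mono) auto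
        also have "\<dots> = exp (- (\<gamma> * (2 * \<beta>\<^sup>2 + \<beta>) * (\<tau> - 1)\<^sup>2) - \<beta> * ln t)"
          using t by (simp add: powr_def exp_add[symmetric])
        also have "\<dots> \<le> exp (\<gamma> * ln (1 - y))" using low by simp
        also have "\<dots> = sun_kernel \<alpha> \<gamma> t"
          using y by (simp add: sun_kernel_eq(2)[OF t True] \<tau>_def[symmetric] ky powr_def[of "1 - y"])
        finally show ?thesis by (simp add: z_def)
      qed
    qed
  qed
  then show ?thesis using C unfolding \<beta>_def by (intro exI[of _ "C1 + C2 + C3"]) auto
qed

lemma sun_kernel_log_concave_kernel: "\<exists>C. log_concave_kernel (sun_kernel \<alpha> \<gamma>) sun_b sun_\<beta> C"
proof -
  obtain C where C: "0 \<le> C" "\<And>t. 1 \<le> t \<Longrightarrow> t powr (- sun_\<beta>) * (1 - C * (1 - 1 / t)\<^sup>2) \<le> sun_kernel \<alpha> \<gamma> t"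
    using sun_kernel_lower by blast
  have "log_concave_kernel (sun_kernel \<alpha> \<gamma>) sun_b sun_\<beta> C"
  proof
    show "sun_kernel \<alpha> \<gamma> \<in> borel_measurable borel" unfolding sun_kernel_def[abs_def] by measurable
    show "0 < sun_kernel \<alpha> \<gamma> t" if "1 \<le> t" "t < sun_b" for t
      using sun_kernel_eq[OF that] \<alpha> by simp
  qed (use \<alpha> sun_b_gt_1 C sun_kernel_eq_0 sun_kernel_isCont sun_kernel_tp2 sun_kernel_upper in auto)
  then show ?thesis by blast
qed

end

lemma powr_mult_ln_tendsto_0:
  fixes a :: real
  assumes a: "0 < a"
  shows "((\<lambda>x. x powr a * ln x) \<longlongrightarrow> 0) (at_right 0)"
proof (rule tendsto_sandwich[OF _ _ _ tendsto_const])
  show "\<forall>\<^sub>F x in at_right 0. - (2 / a) * x powr (a / 2) \<le> x powr a * ln x"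
    using eventually_at_right_less[of 0] eventually_at_right_real[OF zero_less_one]
  proof eventually_elim
    case (elim x)
    have "x powr a * (- ln x) \<le> x powr a * (x powr (- (a / 2)) / (a / 2))"
      using elim a by (intro mult_left_mono minus_ln_le_powr) auto
    also have "\<dots> = (2 / a) * x powr (a + - (a / 2))" by (simp only: powr_add) simp
    finally show ?case by simp
  qed
  show "\<forall>\<^sub>F x in at_right 0. x powr a * ln x \<le> 0"
    using eventually_at_right_less[of 0] eventually_at_right_real[OF zero_less_one]
    by eventually_elim (auto intro!: mult_nonneg_nonpos)
  have "((\<lambda>x. x powr (a / 2)) \<longlongrightarrow> 0 powr (a / 2)) (at_right 0)"
    using a by (intro tendsto_powr' tendsto_ident_at tendsto_const)
      (auto intro: eventually_mono[OF eventually_at_right_less])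
  then show "((\<lambda>x. - (2 / a) * x powr (a / 2)) \<longlongrightarrow> 0) (at_right 0)"
    by (intro tendsto_mult_right_zero) simp
qed

text \<open>For the decay of \<open>h\<close>: up to the factor \<open>\<gamma> / x\<close> it is
  \<open>v * f v\<close> with \<open>v = ((1 - \<alpha>) * x) powr \<gamma>\<close>.\<close>

lemma (in kernel_density) mult_f_bound: "\<exists>B. \<forall>v>0. v * f v \<le> B"
proof -
  obtain c where c: "0 < c" "\<And>x. 0 < x \<Longrightarrow> f x \<le> c * (x powr \<beta> * exp (- x))"
    using f_asymptotics by blast
  define M where "M = (2 * (\<beta> + 1)) powr (\<beta> + 1)"
  have "v * f v \<le> c * M" if v: "0 < v" for v
  proof -
    have "v * f v \<le> v * (c * (v powr \<beta> * exp (- v)))" using v c by (intro mult_left_mono) auto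
    also have "\<dots> = c * (v powr (\<beta> + 1) * exp (- v))" using v by (simp add: powr_add)
    also have "\<dots> \<le> c * (M * exp (v / 2) * exp (- v))"
      unfolding M_def using c v \<beta>_pos by (intro mult_left_mono mult_right_mono powr_le_exp_half) auto
    also have "\<dots> = c * M * exp (v / 2 + - v)" by (simp only: exp_add mult.assoc)
    also have "\<dots> \<le> c * M * 1" using c v by (intro mult_left_mono) (auto simp: M_def)
    finally show ?thesis by simp
  qed
  then show ?thesis by blast
qed

text \<open>If \<open>X\<close> has density \<open>h\<close>, then \<open>f\<close> is the density
  of \<open>((1 - \<alpha>) * X) powr \<gamma>\<close>; the map \<open>\<xi>\<close> is the inverse
  substitution and \<open>\<xi>'\<close> its Jacobian. The factor
  \<open>(1 - \<alpha>) powr \<gamma>\<close> makes the equation for \<open>f\<close> free of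
  constants.\<close>

lemma sun_density_kernel_density:
  assumes \<alpha>: "0 < \<alpha>" "\<alpha> < 1" and \<gamma>: "0 < \<gamma>" and h: "sun_weibull_density \<alpha> \<gamma> h"
  shows "\<exists>C f. kernel_density (sun_kernel \<alpha> \<gamma>) (\<alpha> powr (- \<gamma>)) (\<alpha> / (1 - \<alpha>)) C f \<and>
    (\<forall>x>0. h x = \<gamma> * ((1 - \<alpha>) * x) powr \<gamma> / x * f (((1 - \<alpha>) * x) powr \<gamma>))"
proof -
  have h_nn: "\<And>x. 0 < x \<Longrightarrow> 0 \<le> h x" and h_int: "set_integrable lborel {0<..} h"
    and h_mass: "(LINT x:{0<..}|lborel. h x) = 1"
    and h_eq: "\<And>x. 0 < x \<Longrightarrow> h x = \<gamma> / x * (LINT u:{x..x/\<alpha>}|lborel. (x - \<alpha> * u) powr \<gamma> * h u)"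
    using h unfolding sun_weibull_density_def by auto
  \<comment> \<open>Nothing is known about \<open>h\<close> on the left half-line, not even
    measurability, so it is cut off there.\<close>
  define h0 where "h0 x = indicator {0<..} x * h x" for x
  have h0_int: "integrable lborel h0" using h_int by (simp add: set_integrable_def h0_def[abs_def])
  then have [measurable]: "h0 \<in> borel_measurable borel" by (auto dest: borel_measurable_integrable)
  have h0: "h0 x = h x" if "0 < x" for x using that by (simp add: h0_def)
  define \<xi> where "\<xi> w = w powr (1 / \<gamma>) / (1 - \<alpha>)" for w
  define \<xi>' where "\<xi>' w = w powr (1 / \<gamma> - 1) / (\<gamma> * (1 - \<alpha>))" for w
  define \<eta> where "\<eta> u = ((1 - \<alpha>) * u) powr \<gamma>" for u
  define f where "f w = (if 0 < w then \<xi>' w * h0 (\<xi> w) else 0)" for w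
  define b where "b = \<alpha> powr (- \<gamma>)"
  have b1: "1 < b" unfolding b_def by (rule sun_b_gt_1[OF \<alpha> \<gamma>])
  have b_root: "b powr (1 / \<gamma>) = 1 / \<alpha>" unfolding b_def by (rule sun_b_root[OF \<alpha> \<gamma>])
  have \<xi>_pos: "0 < \<xi> w" if "0 < w" for w using that \<alpha> by (simp add: \<xi>_def)
  have \<eta>_pos: "0 < \<eta> w" if "0 < w" for w using that \<alpha> by (simp add: \<eta>_def)
  have \<xi>\<eta>: "\<xi> (\<eta> u) = u" if "0 < u" for u using that \<alpha> \<gamma> by (simp add: \<xi>_def \<eta>_def powr_powr)
  have \<eta>\<xi>: "\<eta> (\<xi> w) = w" if "0 < w" for w using that \<alpha> \<gamma> by (simp add: \<xi>_def \<eta>_def powr_powr)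
  have \<xi>'_eq: "\<xi>' w = \<xi> w / (\<gamma> * w)" if "0 < w" for w
    using that by (simp add: \<xi>'_def \<xi>_def powr_diff)
  have \<xi>'_nn: "0 \<le> \<xi>' w" for w using \<alpha> \<gamma> by (simp add: \<xi>'_def)
  have deriv: "(\<xi> has_field_derivative \<xi>' w) (at w within S)" if "0 < w" for w S
  proof -
    have "((\<lambda>w. w powr (1 / \<gamma>)) has_real_derivative 1 / \<gamma> * w powr (1 / \<gamma> - 1)) (at w)"
      using that by (rule has_real_derivative_powr)
    from DERIV_cdivide[OF this, of "1 - \<alpha>"] have "(\<xi> has_field_derivative \<xi>' w) (at w)"
      by (simp add: \<xi>_def[abs_def] \<xi>'_def)
    then show ?thesis by (rule has_field_derivative_at_within)
  qed
  have inj: "inj_on \<xi> S" if "S \<subseteq> {0<..}" for S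
    by (rule inj_on_inverseI[of _ \<eta>]) (use that \<eta>\<xi> in auto)
  have \<xi>_mono: "\<xi> v \<le> \<xi> w" if "0 < v" "v \<le> w" for v w
    using that \<alpha> \<gamma> by (auto simp: \<xi>_def intro!: divide_right_mono powr_mono2)
  have \<eta>_mono: "\<eta> v \<le> \<eta> w" if "0 < v" "v \<le> w" for v w
    using that \<alpha> \<gamma> by (auto simp: \<eta>_def intro!: powr_mono2 mult_left_mono)
  have img: "\<xi> ` {0<..} = {0<..}"
  proof safe
    fix u :: real assume "0 < u"
    then show "u \<in> \<xi> ` {0<..}" using \<xi>\<eta>[of u] \<eta>_pos[of u] by (intro image_eqI[of _ _ "\<eta> u"]) auto
  qed (use \<xi>_pos in auto)
  have f_borel: "f \<in> borel_measurable borel"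
    unfolding f_def[abs_def] \<xi>_def[abs_def] \<xi>'_def[abs_def] by measurable
  have f_nn: "0 \<le> f w" for w
    using h_nn \<xi>_pos h0 \<xi>'_nn by (simp add: f_def)
  have f_eq: "f w = \<xi>' w * h (\<xi> w)" if "0 < w" for w using that \<xi>_pos h0 by (simp add: f_def)
  have f_ind: "(\<lambda>w. indicator {0<..} w *\<^sub>R (\<xi>' w * h (\<xi> w))) = f"
    using \<xi>_pos h0 by (auto simp: f_def fun_eq_iff indicator_def)
  have cov: "set_integrable lborel {0<..} (\<lambda>w. \<xi>' w * h (\<xi> w))"
    "(LINT w:{0<..}|lborel. \<xi>' w * h (\<xi> w)) = (LINT u:{0<..}|lborel. h u)"
    using lborel_change_of_variables[of "{0<..}" \<xi> h \<xi>', unfolded f_ind img, OF _ h_int deriv inj \<xi>'_nn f_borel]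
    by auto
  have f_int: "integrable lborel f"
    using cov(1) unfolding set_integrable_def f_ind .
  have f_mass: "(LINT w|lborel. f w) = 1"
    using cov(2) h_mass unfolding set_lebesgue_integral_def f_ind by simp
  have f_fix: "f v = (LINT w|lborel. sun_kernel \<alpha> \<gamma> (w / v) * f w)" if v: "0 < v" for v
  proof -
    define x where "x = \<xi> v"
    have x: "0 < x" "v = \<eta> x" using \<xi>_pos[OF v] \<eta>\<xi>[OF v] by (auto simp: x_def)
    define F where "F u = (x - \<alpha> * u) powr \<gamma> * h u" for u
    have img2: "\<xi> ` {v..b * v} = {x..x / \<alpha>}"
    proof (intro equalityI subsetI)
      have xb: "\<xi> (b * v) = x / \<alpha>" using v b1 b_root by (simp add: \<xi>_def x_def powr_mult)
      fix u assume "u \<in> \<xi> ` {v..b * v}"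
      then obtain w where w: "v \<le> w" "w \<le> b * v" "u = \<xi> w" by auto
      then show "u \<in> {x..x / \<alpha>}" using \<xi>_mono[of v w] \<xi>_mono[of w "b * v"] v xb by (auto simp: x_def)
    next
      have xb: "\<eta> (x / \<alpha>) = b * v"
        using x \<alpha> by (simp add: \<eta>_def b_def powr_divide powr_minus_divide powr_mult)
      fix u assume u: "u \<in> {x..x / \<alpha>}"
      then have u0: "0 < u" using x by auto
      then have "\<eta> u \<in> {v..b * v}" using \<eta>_mono[of x u] \<eta>_mono[of u "x / \<alpha>"] u x xb by auto
      then show "u \<in> \<xi> ` {v..b * v}" using \<xi>\<eta>[OF u0] by (intro image_eqI[of _ _ "\<eta> u"]) auto
    qed
    have F_int: "set_integrable lborel {x..x / \<alpha>} F"
      unfolding set_integrable_def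
    proof (rule Bochner_Integration.integrable_bound)
      show "integrable lborel (\<lambda>u. x powr \<gamma> * h0 u)" using h0_int by simp
      have "(\<lambda>u. indicator {x..x / \<alpha>} u *\<^sub>R F u) = (\<lambda>u. indicator {x..x / \<alpha>} u * ((x - \<alpha> * u) powr \<gamma> * h0 u))"
        using x h0 by (auto simp: fun_eq_iff F_def indicator_def)
      then show "(\<lambda>u. indicator {x..x / \<alpha>} u *\<^sub>R F u) \<in> borel_measurable lborel" by simp
      show "AE u in lborel. norm (indicator {x..x / \<alpha>} u *\<^sub>R F u) \<le> norm (x powr \<gamma> * h0 u)"
      proof (intro AE_I2)
        fix u
        show "norm (indicator {x..x / \<alpha>} u *\<^sub>R F u) \<le> norm (x powr \<gamma> * h0 u)"
        proof (cases "u \<in> {x..x / \<alpha>}")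
          case True
          then have u: "0 < u" "\<alpha> * u \<le> x" "x \<le> u" using x \<alpha> by (auto simp: field_simps)
          then have "(x - \<alpha> * u) powr \<gamma> \<le> x powr \<gamma>" using \<alpha> \<gamma> by (intro powr_mono2) auto
          then show ?thesis using True u h0 h_nn by (auto simp: F_def abs_mult intro!: mult_right_mono)
        qed simp
      qed
    qed
    \<comment> \<open>With \<open>x = \<xi> v\<close>, homogeneity takes \<open>v\<close> out of
      \<open>(x - \<alpha> * \<xi> w) powr \<gamma>\<close> and leaves the kernel at
      \<open>w / v\<close>.\<close>
    have key: "\<xi>' w * F (\<xi> w) = v * (sun_kernel \<alpha> \<gamma> (w / v) * f w)" if w: "w \<in> {v..b * v}" for w
    proof -
      have w0: "0 < w" "1 \<le> w / v" "w / v \<le> b" using w v by (auto simp: field_simps)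
      define q where "q = (1 - \<alpha> * (w / v) powr (1 / \<gamma>)) / (1 - \<alpha>)"
      have "(w / v) powr (1 / \<gamma>) \<le> 1 / \<alpha>"
        using w0 \<gamma> unfolding b_root[symmetric] by (intro powr_mono2) auto
      then have q: "0 \<le> q" using \<alpha> by (simp add: q_def field_simps)
      have "x - \<alpha> * \<xi> w = (v powr (1 / \<gamma>) - \<alpha> * w powr (1 / \<gamma>)) / (1 - \<alpha>)"
        by (simp add: x_def \<xi>_def diff_divide_distrib)
      also have "\<dots> = v powr (1 / \<gamma>) * q"
        using v w0 by (simp add: q_def powr_divide right_diff_distrib)
      finally have "x - \<alpha> * \<xi> w = v powr (1 / \<gamma>) * q" .
      then have "(x - \<alpha> * \<xi> w) powr \<gamma> = v * q powr \<gamma>"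
        using v q \<gamma> by (simp add: powr_mult powr_powr)
      also have "q powr \<gamma> = sun_kernel \<alpha> \<gamma> (w / v)"
        using w0 q by (simp add: sun_kernel_def q_def[symmetric] max_def)
      finally show ?thesis using f_eq[OF w0(1)] by (simp add: F_def)
    qed
    have meas: "(\<lambda>w. indicator {v..b * v} w *\<^sub>R (\<xi>' w * F (\<xi> w))) \<in> borel_measurable borel"
    proof -
      have "(\<lambda>w. indicator {v..b * v} w *\<^sub>R (\<xi>' w * F (\<xi> w))) =
          (\<lambda>w. indicator {v..b * v} w * (v * (sun_kernel \<alpha> \<gamma> (w / v) * f w)))"
        using key by (auto simp: fun_eq_iff indicator_def)
      moreover have "sun_kernel \<alpha> \<gamma> \<in> borel_measurable borel"
        unfolding sun_kernel_def[abs_def] by measurable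
      ultimately show ?thesis using f_borel by simp
    qed
    have "(LINT w:{v..b * v}|lborel. \<xi>' w * F (\<xi> w)) = (LINT u:{x..x / \<alpha>}|lborel. F u)"
      using v by (intro lborel_change_of_variables(2)[of "{v..b * v}" \<xi> F \<xi>', unfolded img2, OF _ F_int deriv inj \<xi>'_nn meas]) auto
    moreover have "(LINT w:{v..b * v}|lborel. \<xi>' w * F (\<xi> w)) = (LINT w|lborel. v * (sun_kernel \<alpha> \<gamma> (w / v) * f w))"
      unfolding set_lebesgue_integral_def
    proof (rule Bochner_Integration.integral_cong[OF refl])
      fix w
      show "indicator {v..b * v} w *\<^sub>R (\<xi>' w * F (\<xi> w)) = v * (sun_kernel \<alpha> \<gamma> (w / v) * f w)"
      proof (cases "w \<in> {v..b * v}")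
        case False
        then have "w / v < 1 \<or> b \<le> w / v" using v by (auto simp: field_simps)
        then show ?thesis using sun_kernel_eq_0[OF \<alpha> \<gamma>, of "w / v"] False by (simp add: b_def)
      qed (simp add: key)
    qed
    \<comment> \<open>The factors \<open>\<gamma> / x\<close> and \<open>v\<close> cancel against
      the Jacobian \<open>x / (\<gamma> * v)\<close> at \<open>v\<close>.\<close>
    ultimately have "h x = \<gamma> / x * (v * (LINT w|lborel. sun_kernel \<alpha> \<gamma> (w / v) * f w))"
      using h_eq[OF x(1)] by (simp add: F_def)
    moreover have "f v = x / (\<gamma> * v) * h x" using f_eq[OF v] \<xi>'_eq[OF v] by (simp add: x_def)
    ultimately show ?thesis using x(1) v \<gamma> by simp
  qed
  obtain C where C: "log_concave_kernel (sun_kernel \<alpha> \<gamma>) b (\<alpha> / (1 - \<alpha>)) C"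
    unfolding b_def using sun_kernel_log_concave_kernel[OF \<alpha> \<gamma>] by blast
  have "kernel_density (sun_kernel \<alpha> \<gamma>) b (\<alpha> / (1 - \<alpha>)) C f"
    by (intro kernel_density.intro C kernel_density_axioms.intro f_borel f_nn f_int f_fix)
       (auto simp: f_mass, simp add: f_def)
  moreover have "h x = \<gamma> * ((1 - \<alpha>) * x) powr \<gamma> / x * f (((1 - \<alpha>) * x) powr \<gamma>)" if x: "0 < x" for x
    using f_eq[OF \<eta>_pos[OF x]] \<xi>'_eq[OF \<eta>_pos[OF x]] \<xi>\<eta>[OF x] x \<gamma> \<eta>_pos[OF x]
    by (simp add: \<eta>_def[symmetric])
  ultimately show ?thesis unfolding b_def by blast
qed

section \<open>Transfer from the fixed point back to the density\<close>

theorem theorem3: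
  fixes \<alpha> \<gamma> :: real and h :: "real \<Rightarrow> real"
  assumes "0 < \<alpha>" and "\<alpha> < 1" and "\<gamma> > 0"
    and "sun_weibull_density \<alpha> \<gamma> h"
  shows "strictly_unimodal_on_pos h
    \<and> (\<forall>a>0. ((\<lambda>x. x powr (- a) * h x) \<longlongrightarrow> 0) (at_right 0)
            \<and> ((\<lambda>x. x powr a * ln (h x)) \<longlongrightarrow> 0) (at_right 0))
    \<and> (\<exists>c>0. h \<sim>[at_top]
          (\<lambda>x. c * x powr (\<gamma> / (1 - \<alpha>) - 1) * exp (- (((1 - \<alpha>) * x) powr \<gamma>))))"
proof -
  note \<alpha> = assms(1,2) and \<gamma> = assms(3)
  obtain C f where kd: "kernel_density (sun_kernel \<alpha> \<gamma>) (\<alpha> powr (- \<gamma>)) (\<alpha> / (1 - \<alpha>)) C f"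
    and hf: "\<And>x. 0 < x \<Longrightarrow> h x = \<gamma> * ((1 - \<alpha>) * x) powr \<gamma> / x * f (((1 - \<alpha>) * x) powr \<gamma>)"
    using sun_density_kernel_density[OF assms] by blast
  interpret kernel_density "sun_kernel \<alpha> \<gamma>" "\<alpha> powr (- \<gamma>)" "\<alpha> / (1 - \<alpha>)" C f by (rule kd)
  define v where "v x = ((1 - \<alpha>) * x) powr \<gamma>" for x
  have v_pos: "0 < v x" if "0 < x" for x using that \<alpha> by (simp add: v_def)
  have h_eq: "h x = \<gamma> * v x / x * f (v x)" if "0 < x" for x using hf[OF that] by (simp add: v_def)
  have h_pos: "0 < h x" if "0 < x" for x
    using that f_pos[OF v_pos[OF that]] v_pos[OF that] \<gamma> by (simp add: h_eq)
  have v_scale: "v (\<rho> * x) = \<rho> powr \<gamma> * v x" if "0 < \<rho>" "0 < x" for \<rho> x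
    using that \<alpha> by (simp add: v_def powr_mult[symmetric] mult_ac)
  have v_0: "filterlim v (at_right 0) (at_right 0)"
    unfolding filterlim_at
  proof (intro conjI)
    have "((\<lambda>x. ((1 - \<alpha>) * x) powr \<gamma>) \<longlongrightarrow> ((1 - \<alpha>) * 0) powr \<gamma>) (at_right 0)"
      using \<gamma> \<alpha> by (intro tendsto_powr' tendsto_mult tendsto_ident_at tendsto_const)
        (auto intro: eventually_mono[OF eventually_at_right_less])
    then show "(v \<longlongrightarrow> 0) (at_right 0)" by (simp add: v_def[abs_def])
    show "\<forall>\<^sub>F x in at_right 0. v x \<in> {0<..} \<and> v x \<noteq> 0"
      using eventually_at_right_less[of 0] by eventually_elim (use v_pos in fastforce)
  qed
  have v_top: "filterlim v at_top at_top"
    unfolding filterlim_at_top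
  proof
    fix Z :: real
    show "\<forall>\<^sub>F x in at_top. Z \<le> v x"
      using eventually_ge_at_top[of "max 1 Z powr (1 / \<gamma>) / (1 - \<alpha>)"]
    proof eventually_elim
      case (elim x)
      have "max 1 Z = (max 1 Z powr (1 / \<gamma>)) powr \<gamma>" using \<gamma> by (simp add: powr_powr)
      also have "\<dots> \<le> v x"
        unfolding v_def using elim \<alpha> \<gamma> by (intro powr_mono2) (auto simp: field_simps)
      finally show ?case by simp
    qed
  qed
  have small: "((\<lambda>x. x powr (- a) * h x) \<longlongrightarrow> 0) (at_right 0)" if a: "0 < a" for a
  proof -
    \<comment> \<open>Large enough for the exponent \<open>p\<close> of the bound to be positive:
      \<open>f\<close> contributes \<open>\<gamma> * real n\<close>, the prefactor
      \<open>\<gamma> - 1\<close>, and \<open>x powr (- a)\<close> takes away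
      \<open>a\<close>.\<close>
    obtain n :: nat where n: "(1 + a) / \<gamma> < real n" using reals_Archimedean2 by blast
    define p where "p = \<gamma> * (real n + 1) - 1 - a"
    have p: "0 < p" using n \<gamma> by (simp add: p_def field_simps)
    obtain B where B: "0 \<le> B" "\<And>x. 0 < x \<Longrightarrow> f x \<le> B * x ^ n" using f_le_power[of n] by blast
    show ?thesis
    proof (rule tendsto_sandwich[OF _ _ tendsto_const])
      show "\<forall>\<^sub>F x in at_right 0. 0 \<le> x powr (- a) * h x"
        using eventually_at_right_less[of 0] by eventually_elim (use h_pos in \<open>auto intro: less_imp_le\<close>)
      show "\<forall>\<^sub>F x in at_right 0. x powr (- a) * h x \<le> (\<gamma> * B * (1 - \<alpha>) powr (\<gamma> * (real n + 1))) * x powr p"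
        using eventually_at_right_less[of 0]
      proof eventually_elim
        case (elim x)
        have "x powr (- a) * h x \<le> x powr (- a) * (\<gamma> * v x / x * (B * v x ^ n))"
          using B(2)[OF v_pos[OF elim]] v_pos[OF elim] elim \<gamma>
          by (auto simp: h_eq intro!: mult_left_mono divide_right_mono)
        also have "\<dots> = x powr (- a) * (\<gamma> * B) * (v x * v x ^ n) / x" by simp
        also have "v x * v x ^ n = v x powr (real n + 1)"
          using v_pos[OF elim] by (simp add: powr_add powr_realpow)
        also have "\<dots> = (1 - \<alpha>) powr (\<gamma> * (real n + 1)) * x powr (\<gamma> * (real n + 1))"
          using elim \<alpha> by (simp add: v_def powr_powr powr_mult)
        also have "x powr (- a) * (\<gamma> * B) * \<dots> / x =
            (\<gamma> * B * (1 - \<alpha>) powr (\<gamma> * (real n + 1))) * x powr p"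
          using elim by (simp add: p_def powr_diff powr_minus divide_inverse)
        finally show ?case .
      qed
      have "((\<lambda>x. x powr p) \<longlongrightarrow> 0 powr p) (at_right 0)"
        using p by (intro tendsto_powr' tendsto_ident_at tendsto_const)
          (auto intro: eventually_mono[OF eventually_at_right_less])
      then show "((\<lambda>x. (\<gamma> * B * (1 - \<alpha>) powr (\<gamma> * (real n + 1))) * x powr p) \<longlongrightarrow> 0) (at_right 0)"
        by (intro tendsto_mult_right_zero) simp
    qed
  qed
  have log: "((\<lambda>x. x powr a * ln (h x)) \<longlongrightarrow> 0) (at_right 0)" if a: "0 < a" for a
  proof -
    have "((\<lambda>x. x powr a) \<longlongrightarrow> 0 powr a) (at_right 0)"
      using a by (intro tendsto_powr' tendsto_ident_at tendsto_const)
        (auto intro: eventually_mono[OF eventually_at_right_less])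
    then have l1: "((\<lambda>x. x powr a) \<longlongrightarrow> 0) (at_right 0)" by simp
    \<comment> \<open>The exponent for which \<open>v x powr (a / \<gamma>)\<close> is a constant
      multiple of \<open>x powr a\<close>.\<close>
    have "0 < a / \<gamma>" using a \<gamma> by simp
    from filterlim_compose[OF ln_f_tendsto_0[OF this] v_0]
    have l2: "((\<lambda>x. v x powr (a / \<gamma>) * ln (f (v x))) \<longlongrightarrow> 0) (at_right 0)" .
    have "((\<lambda>x. (ln \<gamma> + \<gamma> * ln (1 - \<alpha>)) * x powr a + (\<gamma> - 1) * (x powr a * ln x)
        + (1 - \<alpha>) powr (- a) * (v x powr (a / \<gamma>) * ln (f (v x)))) \<longlongrightarrow> 0) (at_right 0)"
      by (intro tendsto_add_zero tendsto_mult_right_zero l1 l2 powr_mult_ln_tendsto_0 a)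
    moreover have "\<forall>\<^sub>F x in at_right 0. (ln \<gamma> + \<gamma> * ln (1 - \<alpha>)) * x powr a + (\<gamma> - 1) * (x powr a * ln x)
        + (1 - \<alpha>) powr (- a) * (v x powr (a / \<gamma>) * ln (f (v x))) = x powr a * ln (h x)"
      using eventually_at_right_less[of 0]
    proof eventually_elim
      case (elim x)
      have lh: "ln (h x) = ln \<gamma> + ln (v x) - ln x + ln (f (v x))"
        using elim \<gamma> v_pos[OF elim] f_pos[OF v_pos[OF elim]] by (simp add: h_eq ln_mult ln_div)
      have lv: "ln (v x) = \<gamma> * (ln (1 - \<alpha>) + ln x)"
        using elim \<alpha> by (simp add: v_def ln_powr ln_mult)
      have "(1 - \<alpha>) powr (- a) * v x powr (a / \<gamma>) = x powr a"
        using elim \<alpha> \<gamma> by (simp add: v_def powr_powr powr_mult powr_minus)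
      then have "(1 - \<alpha>) powr (- a) * (v x powr (a / \<gamma>) * ln (f (v x))) = x powr a * ln (f (v x))"
        by (simp only: mult.assoc[symmetric])
      then show ?case unfolding lh lv by (simp add: algebra_simps)
    qed
    ultimately show ?thesis by (rule Lim_transform_eventually)
  qed
  have unimodal: "strictly_unimodal_on_pos h"
  proof -
    have "\<exists>m>0. strict_mono_on {0<..<m} h \<and> strict_antimono_on {m<..} h"
    proof (rule strictly_unimodal_ex_mode)
      fix x :: real assume x: "0 < x"
      show "0 < h x" by (rule h_pos[OF x])
      have "isCont (\<lambda>x. \<gamma> * v x / x * f (v x)) x"
      proof -
        have "isCont v x" unfolding v_def[abs_def] using x \<alpha> by (intro continuous_intros) auto
        moreover from this have "isCont (\<lambda>x. f (v x)) x"
          by (rule isCont_o2) (rule f_isCont[OF v_pos[OF x]])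
        ultimately show ?thesis using x by (intro continuous_intros) auto
      qed
      moreover have "\<forall>\<^sub>F y in nhds x. h y = \<gamma> * v y / y * f (v y)"
        using x h_eq by (auto simp: eventually_nhds intro!: exI[of _ "{0<..}"])
      ultimately show "isCont h x" by (subst isCont_cong) auto
    next
      have "((\<lambda>x. x * (x powr (- 1) * h x)) \<longlongrightarrow> 0) (at_right 0)"
        using tendsto_mult[OF tendsto_ident_at small[OF zero_less_one]] by simp
      moreover have "\<forall>\<^sub>F x in at_right 0. x * (x powr (- 1) * h x) = h x"
        using eventually_at_right_less[of 0] by eventually_elim (simp add: powr_minus_divide)
      ultimately show "(h \<longlongrightarrow> 0) (at_right 0)" by (rule Lim_transform_eventually)
    next
      obtain B where B: "\<And>v. 0 < v \<Longrightarrow> v * f v \<le> B" using mult_f_bound by blast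
      show "(h \<longlongrightarrow> 0) at_top"
      proof (rule tendsto_sandwich[OF _ _ tendsto_const])
        show "\<forall>\<^sub>F x in at_top. 0 \<le> h x"
          using eventually_gt_at_top[of 0] by eventually_elim (use h_pos in \<open>auto intro: less_imp_le\<close>)
        show "\<forall>\<^sub>F x in at_top. h x \<le> \<gamma> * B / x"
          using eventually_gt_at_top[of 0]
        proof eventually_elim
          case (elim x)
          have "\<gamma> * (v x * f (v x)) / x \<le> \<gamma> * B / x"
            using B[OF v_pos[OF elim]] \<gamma> elim by (intro divide_right_mono mult_left_mono) auto
          then show ?case using elim by (simp add: h_eq mult_ac)
        qed
        show "((\<lambda>x. \<gamma> * B / x) \<longlongrightarrow> 0) at_top"
          by (intro tendsto_divide_0[OF tendsto_const] filterlim_at_top_imp_at_infinity filterlim_ident)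
      qed
    next
      fix x x' \<rho> :: real assume *: "0 < x" "x < x'" "1 < \<rho>"
      \<comment> \<open>\<open>h x\<close> is a power of \<open>x\<close> times
        \<open>f (v x)\<close>. The power contributes the same positive factor to both sides, and
        \<open>v\<close> turns the dilation \<open>\<rho>\<close> into
        \<open>\<rho> powr \<gamma>\<close>, so strictness carries over.\<close>
      have "f (v x) * f (\<rho> powr \<gamma> * v x') < f (\<rho> powr \<gamma> * v x) * f (v x')"
      proof (rule f_strict)
        show "v x < v x'" using * \<alpha> \<gamma> by (auto simp: v_def intro!: powr_less_mono2)
        show "1 < \<rho> powr \<gamma>" using * \<gamma> powr_less_mono2[of \<gamma> 1 \<rho>] by simp
      qed (use * v_pos in auto)
      then have "(\<gamma> * v x / x * (\<gamma> * (\<rho> powr \<gamma> * v x') / (\<rho> * x'))) * (f (v x) * f (\<rho> powr \<gamma> * v x')) <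
          (\<gamma> * v x / x * (\<gamma> * (\<rho> powr \<gamma> * v x') / (\<rho> * x'))) * (f (\<rho> powr \<gamma> * v x) * f (v x'))"
        using * \<gamma> v_pos by (intro mult_strict_left_mono mult_pos_pos divide_pos_pos) auto
      then show "h x * h (\<rho> * x') < h (\<rho> * x) * h x'"
        using * by (simp add: h_eq v_scale mult_ac)
    qed
    then show ?thesis unfolding strictly_unimodal_on_pos_def by (meson less_imp_le)
  qed
  have tail: "\<exists>c>0. h \<sim>[at_top]
          (\<lambda>x. c * x powr (\<gamma> / (1 - \<alpha>) - 1) * exp (- (((1 - \<alpha>) * x) powr \<gamma>)))"
  proof -
    obtain c where c: "0 < c" and lim: "((\<lambda>x. exp x * (x powr (- (\<alpha> / (1 - \<alpha>))) * f x)) \<longlongrightarrow> c) at_top"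
      using f_asymptotics by blast
    \<comment> \<open>The prefactor \<open>\<gamma> * v / x\<close> raises the exponent of
      \<open>v\<close> from \<open>\<alpha> / (1 - \<alpha>)\<close> to
      \<open>1 / (1 - \<alpha>)\<close>. Expressed in \<open>x\<close>, this gives the exponent
      \<open>\<gamma> / (1 - \<alpha>) - 1\<close> and the constants collected in
      \<open>d\<close>.\<close>
    define d where "d = c * \<gamma> * (1 - \<alpha>) powr (\<gamma> / (1 - \<alpha>))"
    have d: "0 < d" using c \<gamma> \<alpha> by (simp add: d_def)
    have "((\<lambda>x. exp (v x) * (v x powr (- (\<alpha> / (1 - \<alpha>))) * f (v x)) / c) \<longlongrightarrow> c / c) at_top"
      using c by (intro tendsto_divide filterlim_compose[OF lim v_top] tendsto_const) auto
    moreover have "\<forall>\<^sub>F x in at_top. exp (v x) * (v x powr (- (\<alpha> / (1 - \<alpha>))) * f (v x)) / c =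
        h x / (d * x powr (\<gamma> / (1 - \<alpha>) - 1) * exp (- v x))"
      using eventually_gt_at_top[of 0]
    proof eventually_elim
      case (elim x)
      have e: "1 / (1 - \<alpha>) = \<alpha> / (1 - \<alpha>) + 1" using \<alpha> by (simp add: field_simps)
      have "(1 - \<alpha>) powr (\<gamma> / (1 - \<alpha>)) * x powr (\<gamma> / (1 - \<alpha>)) = v x powr (1 / (1 - \<alpha>))"
        using elim \<alpha> by (simp add: v_def powr_powr powr_mult)
      also have "\<dots> = v x powr (\<alpha> / (1 - \<alpha>)) * v x"
        unfolding e powr_add using v_pos[OF elim] by simp
      finally have "d * x powr (\<gamma> / (1 - \<alpha>) - 1) = c * \<gamma> * (v x powr (\<alpha> / (1 - \<alpha>)) * v x) / x"
        using elim by (simp add: d_def powr_diff)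
      then show ?case using elim c \<gamma> v_pos[OF elim]
        by (simp add: h_eq powr_minus exp_minus field_simps)
    qed
    ultimately have "((\<lambda>x. h x / (d * x powr (\<gamma> / (1 - \<alpha>) - 1) * exp (- v x))) \<longlongrightarrow> 1) at_top"
      using c by (auto intro: Lim_transform_eventually)
    then have "h \<sim>[at_top] (\<lambda>x. d * x powr (\<gamma> / (1 - \<alpha>) - 1) * exp (- v x))"
      by (rule asymp_equivI')
    then show ?thesis using d unfolding v_def by blast
  qed
  show ?thesis using unimodal small log tail by blast
qed

end
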